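(* Let $s:\mathbb{R}\to\mathbb{R}^3$ be a sufficiently smooth regular curve, let $u,\varepsilon\in\mathbb{R}$ with $\kappa(u)\ne0$, and let $\gamma:\mathbb{Z}\to\mathbb{R}^3$ be the discrete curve $\gamma_k=\gamma(k)=s(u+(2k-1)\varepsilon)$. Then the discrete Frenet frame $(T_0,N_0,B_0)$ of $\gamma$ at the edge $\gamma_0\gamma_1$ (after appropriate orientation) is a second order approximation of the smooth Frenet frame $(T,N,B)$ of $s$ at $u$: as $\varepsilon\to0$ (with $\varepsilon\neq0$), $$T_0=T+O(\varepsilon^2),\qquad N_0=N+O(\varepsilon^2),\qquad B_0=B+O(\varepsilon^2).$$
   Context: Regular means $s'\neq0$ everywhere; sufficiently smooth means of class $C^k$ with $k$ large enough. $\kappa=\|s'\times s''\|/\|s'\|^3$, $T=s'/\|s'\|$, $B=(s'\times s'')/\|s'\times s''\|$, $N=B\times T$. Quaternions are written $[r,v]$ with $r\in\mathbb{R}$, $v\in\mathbb{R}^3$, with product $[r,v][s,w]=[rs-\langle v,w\rangle,\,rw+sv+v\times w]$, and $\mathbb{R}^3$ is identified with $\mathrm{Im}\,\mathbb{H}$ via $v\leftrightarrow[0,v]$. For $q=|q|[\cos\phi,v\sin\phi]$ with $\|v\|=1$, $\phi\in[0,\pi]$, set $\sqrt q=\sqrt{|q|}\,[\cos\frac\phi2,v\sin\frac\phi2]$ (well defined unless $q$ is a negative real). The cross-ratio is $\mathrm{cr}(a,b,c,d)=(a-b)(b-c)^{-1}(c-d)(d-a)^{-1}$. For pairwise distinct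 $a,b,c,d\in\mathrm{Im}\,\mathbb{H}$ with $\mathrm{cr}(c,a,b,d)\notin\mathbb{R}_{<0}$ set $$f(a,b,c,d)=\big((b-a)(c-a)^{-1}\sqrt{\mathrm{cr}(c,a,b,d)}+1\big)^{-1}\big((b-a)(c-a)^{-1}\sqrt{\mathrm{cr}(c,a,b,d)}\,c+b\big)\in\mathbb{R}^3\cup\{\infty\}.$$ For a discrete curve $\gamma:\mathbb{Z}\to\mathbb{R}^3$ and $(a,b,c,d)=(\gamma_{i-1},\gamma_i,\gamma_{i+1},\gamma_{i+2})$ put $p_{ab}=f(d,a,b,c)$, $p_{bc}=f(a,b,c,d)$, $p_{cd}=f(b,c,d,a)$, $p_{da}=f(c,d,a,b)$ (cross-ratios involved assumed not negative real). These four points lie on a common circle $k_i$, the discrete curvature circle at the edge $\gamma_i\gamma_{i+1}$. The discrete Frenet frame at this edge consists of: the unit tangent vector $T_i$ of $k_i$ at $p_{bc}$; the unit normal $N_i$ of $k_i$ at $p_{bc}$ lying in the plane of $k_i$; and the unit vector $B_i$ orthogonal to $T_i$ and $N_i$. The orientation of $N_i$ is towards the center of $k_i$, that of $T_i$ is in the direction of traversal of the curve, and $B_i=T_i\times N_i$. *)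

theory Defs
  imports "HOL-Analysis.Analysis" "HOL-Library.Landau_Symbols"
begin

unbundle cross3_syntax

section \<open>Quaternions\<close>

datatype quat = Quat (qre: real) (qim: "real^3")

lemma quat_eq_iff: "x = y \<longleftrightarrow> qre x = qre y \<and> qim x = qim y"
  by (cases x; cases y) auto

instantiation quat :: real_vector
begin

definition "0 = Quat 0 0"
definition "x + y = Quat (qre x + qre y) (qim x + qim y)"
definition "- x = Quat (- qre x) (- qim x)"
definition "x - y = Quat (qre x - qre y) (qim x - qim y)" for x y :: quat
definition "scaleR t x = Quat (t * qre x) (t *\<^sub>R qim x)"

instance
  by standard
    (simp_all add: zero_quat_def plus_quat_def uminus_quat_def minus_quat_def scaleR_quat_def
      algebra_simps)

end

lemma quat_linear_simps [simp]:
  "qre 0 = 0" "qim 0 = 0"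
  "qre (x + y) = qre x + qre y" "qim (x + y) = qim x + qim y"
  "qre (- x) = - qre x" "qim (- x) = - qim x"
  "qre (x - y) = qre x - qre y" "qim (x - y) = qim x - qim y"
  "qre (t *\<^sub>R x) = t * qre x" "qim (t *\<^sub>R x) = t *\<^sub>R qim x"
  by (simp_all add: zero_quat_def plus_quat_def uminus_quat_def minus_quat_def scaleR_quat_def)

instantiation quat :: real_normed_div_algebra
begin

definition "1 = Quat 1 0"

definition times_quat_def:
  "x * y = Quat (qre x * qre y - qim x \<bullet> qim y)
                (qre x *\<^sub>R qim y + qre y *\<^sub>R qim x + qim x \<times> qim y)" for x y :: quat

definition "norm x = sqrt ((qre x)\<^sup>2 + (norm (qim x))\<^sup>2)"

definition inverse_quat_def:
  "inverse x = (1 / (norm x)\<^sup>2) *\<^sub>R Quat (qre x) (- qim x)" for x :: quat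

definition "x div y = x * inverse y" for x y :: quat

definition sgn_quat_def: "sgn x = x /\<^sub>R norm x" for x :: quat

definition dist_quat_def: "dist x y = norm (x - y)" for x y :: quat

definition uniformity_quat_def [code del]:
  "(uniformity :: (quat \<times> quat) filter) = (INF e\<in>{0 <..}. principal {(x, y). dist x y < e})"

definition open_quat_def [code del]:
  "open (U :: quat set) \<longleftrightarrow> (\<forall>x\<in>U. eventually (\<lambda>(x', y). x' = x \<longrightarrow> y \<in> U) uniformity)"

instance
proof
  fix r :: real and x y z :: quat
  show "x * y * z = x * (y * z)"
    unfolding times_quat_def quat_eq_iff
    by (simp add: inner_vec_def sum_3 vec_eq_iff forall_3 cross_components algebra_simps)
  show "(x + y) * z = x * z + y * z"
    by (simp add: times_quat_def quat_eq_iff inner_add_left cross_add_left algebra_simps)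
  show "x * (y + z) = x * y + x * z"
    by (simp add: times_quat_def quat_eq_iff inner_add_right cross_add_right algebra_simps)
  show "r *\<^sub>R x * y = r *\<^sub>R (x * y)" "x * r *\<^sub>R y = r *\<^sub>R (x * y)"
    by (simp_all add: times_quat_def quat_eq_iff cross_mult_left cross_mult_right algebra_simps)
  show "1 * x = x" "x * 1 = x" "(0::quat) \<noteq> 1"
    by (simp_all add: times_quat_def one_quat_def quat_eq_iff)
  have nz: "(norm x)\<^sup>2 \<noteq> 0" if "x \<noteq> 0"
    using that
    by (auto simp: norm_quat_def quat_eq_iff sum_power2_eq_zero_iff simp flip: power2_norm_eq_inner)
  have nsq: "(norm x)\<^sup>2 = qre x * qre x + qim x \<bullet> qim x"
    by (simp add: norm_quat_def power2_norm_eq_inner power2_eq_square[of "qre x"])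
  show "x \<noteq> 0 \<Longrightarrow> inverse x * x = 1" "x \<noteq> 0 \<Longrightarrow> x * inverse x = 1"
    using nz nsq
    by (simp_all add: inverse_quat_def times_quat_def one_quat_def quat_eq_iff cross_mult_left
        cross_mult_right cross_refl flip: add_divide_distrib)
  show "inverse (0::quat) = 0"
    by (simp add: inverse_quat_def quat_eq_iff)
  show "x div y = x * inverse y"
    by (rule divide_quat_def)
  show "(norm x = 0) = (x = 0)"
    by (simp add: norm_quat_def quat_eq_iff sum_power2_eq_zero_iff)
  have norm_Pair: "norm q = norm (qre q, qim q)" for q
    by (simp add: norm_quat_def norm_Pair)
  show "norm (x + y) \<le> norm x + norm y"
    using norm_triangle_ineq[of "(qre x, qim x)" "(qre y, qim y)"] by (simp add: norm_Pair)
  show "norm (r *\<^sub>R x) = \<bar>r\<bar> * norm x"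
    using norm_scaleR[of r "(qre x, qim x)"] by (simp add: norm_Pair)
  show "norm (x * y) = norm x * norm y"
    unfolding norm_quat_def real_sqrt_mult[symmetric] times_quat_def power2_norm_eq_inner
    by (simp add: inner_vec_def sum_3 cross_components power2_eq_square algebra_simps)
qed (rule sgn_quat_def dist_quat_def open_quat_def uniformity_quat_def)+

end

definition imq :: "real^3 \<Rightarrow> quat"
  where "imq v = Quat 0 v"

text \<open>The polar angle of \<open>q\<close> is \<open>arccos (qre q / norm q)\<close> and its axis is \<open>sgn (qim q)\<close>, the
  normalized imaginary part; see \<open>qsqrt_polar\<close>. The value at negative reals is irrelevant.\<close>

definition qsqrt :: "quat \<Rightarrow> quat"
  where "qsqrt q = (let \<phi> = arccos (qre q / norm q) in
           sqrt (norm q) *\<^sub>R Quat (cos (\<phi> / 2)) (sin (\<phi> / 2) *\<^sub>R sgn (qim q)))"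

lemma qsqrt_polar:
  assumes q: "q = r *\<^sub>R Quat (cos \<phi>) (sin \<phi> *\<^sub>R v)"
    and r: "r > 0" and v: "norm v = 1" and phi: "0 \<le> \<phi>" "\<phi> < pi"
  shows "qsqrt q = sqrt (norm q) *\<^sub>R Quat (cos (\<phi> / 2)) (sin (\<phi> / 2) *\<^sub>R v)"
proof -
  have n: "norm q = r"
    using r v by (simp add: q norm_quat_def power_mult_distrib flip: distrib_left)
  then have a: "arccos (qre q / norm q) = \<phi>"
    using q r phi by (simp add: arccos_cos)
  have "sin (\<phi> / 2) *\<^sub>R sgn (qim q) = sin (\<phi> / 2) *\<^sub>R v"
  proof (cases "\<phi> = 0")
    case False
    then have "sin \<phi> > 0" using phi by (simp add: sin_gt_zero)
    then have "sgn (qim q) = v"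
      using r v by (simp add: q sgn_scaleR) (simp add: sgn_div_norm)
    then show ?thesis by simp
  qed simp
  then show ?thesis
    unfolding qsqrt_def Let_def a by simp
qed

definition cross_ratio :: "quat \<Rightarrow> quat \<Rightarrow> quat \<Rightarrow> quat \<Rightarrow> quat"
  where "cross_ratio a b c d = (a - b) * inverse (b - c) * (c - d) * inverse (d - a)"


section \<open>The four points at an edge\<close>

text \<open>Points of \<open>\<real>\<^sup>3 \<union> {\<infinity>}\<close> have type \<^typ>\<open>(real^3) option\<close>, with \<^term>\<open>None\<close> for the
  point at infinity. Taking the imaginary part in \<open>f_point\<close> loses nothing on its domain; see
  \<open>f_point_imaginary\<close>.\<close>

definition f_defined :: "real^3 \<Rightarrow> real^3 \<Rightarrow> real^3 \<Rightarrow> real^3 \<Rightarrow> bool"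
  where "f_defined a b c d \<longleftrightarrow> distinct [a, b, c, d] \<and>
           cross_ratio (imq c) (imq a) (imq b) (imq d) \<notin> of_real ` {..<0}"

definition f_coeff :: "real^3 \<Rightarrow> real^3 \<Rightarrow> real^3 \<Rightarrow> real^3 \<Rightarrow> quat"
  where "f_coeff a b c d = (imq b - imq a) * inverse (imq c - imq a) *
           qsqrt (cross_ratio (imq c) (imq a) (imq b) (imq d))"

definition f_point :: "real^3 \<Rightarrow> real^3 \<Rightarrow> real^3 \<Rightarrow> real^3 \<Rightarrow> (real^3) option"
  where "f_point a b c d = (let w = f_coeff a b c d in
           if w + 1 = 0 then None else Some (qim (inverse (w + 1) * (w * imq c + imq b))))"

lemma qsqrt_in_span:
  assumes "q \<notin> of_real ` {..<0}"
  obtains \<alpha> \<beta> where "qsqrt q = \<alpha> *\<^sub>R 1 + \<beta> *\<^sub>R q"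
proof -
  define \<phi> where "\<phi> = arccos (qre q / norm q)"
  show ?thesis
  proof (cases "qim q = 0")
    case True
    then show ?thesis
      by (intro that[of "sqrt (norm q) * cos (\<phi> / 2)" 0])
        (simp add: qsqrt_def quat_eq_iff one_quat_def Let_def \<phi>_def)
  next
    case False
    show ?thesis
      using False
      by (intro that[of "sqrt (norm q) * cos (\<phi> / 2) - sqrt (norm q) * sin (\<phi> / 2) / norm (qim q) * qre q"
                 "sqrt (norm q) * sin (\<phi> / 2) / norm (qim q)"])
        (simp add: qsqrt_def quat_eq_iff one_quat_def Let_def \<phi>_def sgn_div_norm field_simps)
  qed
qed

lemma f_point_imaginary:
  assumes "f_defined a b c d" "f_coeff a b c d + 1 \<noteq> 0"
  shows "qre (inverse (f_coeff a b c d + 1) * (f_coeff a b c d * imq c + imq b)) = 0"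
proof -
  define A B C D where "A = imq a" and "B = imq b" and "C = imq c" and "D = imq d"
  note ABCD = A_def B_def C_def D_def
  define q x w where "q = cross_ratio C A B D" and "x = (B - A) * inverse (C - A)"
    and "w = f_coeff a b c d"
  have ne: "C - A \<noteq> 0" "A - B \<noteq> 0"
    using assms(1) by (auto simp: f_defined_def ABCD imq_def)
  obtain \<alpha> \<beta> where "qsqrt q = \<alpha> *\<^sub>R 1 + \<beta> *\<^sub>R q"
    using assms(1) qsqrt_in_span unfolding f_defined_def q_def ABCD by blast
  then have w: "w = \<alpha> *\<^sub>R x + \<beta> *\<^sub>R (x * q)"
    by (simp add: w_def f_coeff_def x_def q_def ABCD algebra_simps)
  have "x * q = (B - A) * (inverse (C - A) * (C - A)) * inverse (A - B) * (B - D) * inverse (D - C)"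
    by (simp only: x_def q_def cross_ratio_def mult.assoc)
  also have "\<dots> = (B - A) * inverse (A - B) * (B - D) * inverse (D - C)"
    using ne by simp
  also have "(B - A) * inverse (A - B) = - ((A - B) * inverse (A - B))"
    by (simp add: minus_mult_left)
  also have "\<dots> = - 1"
    using ne by simp
  also have "- 1 * (B - D) * inverse (D - C) = (D - B) * inverse (D - C)"
    by simp
  also have "\<dots> = (B - D) * inverse (C - D)"
    by (metis inverse_minus_eq minus_diff_eq minus_mult_minus)
  finally have xq: "x * q = (B - D) * inverse (C - D)" .
  have orth: "qim ((imq v - imq p) * inverse (imq u - imq p)) \<bullet> (u - v) = 0" for u v p
  proof -
    have "qim ((imq v - imq p) * inverse (imq u - imq p)) =
        (1 / (norm (imq u - imq p))\<^sup>2) *\<^sub>R ((v - p) \<times> (p - u))"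
      by (simp add: imq_def inverse_quat_def times_quat_def cross_mult_right)
    moreover have "((v - p) \<times> (p - u)) \<bullet> (u - v) = 0"
      by (simp add: cross_components inner_vec_def sum_3 algebra_simps)
    ultimately show ?thesis
      by simp
  qed
  have "qim x \<bullet> (b - c) = 0"
    using orth[of b a c] by (simp add: x_def ABCD inner_diff_right)
  moreover have "qim (x * q) \<bullet> (b - c) = 0"
    using orth[of b d c] by (simp add: xq ABCD inner_diff_right)
  ultimately have "qim w \<bullet> (b - c) = 0"
    by (simp add: w inner_add_left)
  then have "qim w \<bullet> b = qim w \<bullet> c"
    by (simp add: inner_diff_right)
  then have "qre (inverse (w + 1) * (w * imq c + imq b)) = 0"
    by (simp add: inverse_quat_def times_quat_def imq_def one_quat_def dot_cross_self
        inner_add_right inner_add_left algebra_simps flip: add_divide_distrib)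
  then show ?thesis
    by (simp add: w_def)
qed


section \<open>The discrete Frenet frame\<close>

definition circle3 :: "real^3 \<Rightarrow> real \<Rightarrow> real^3 \<Rightarrow> (real^3) set"
  where "circle3 z r n = sphere z r \<inter> {x. n \<bullet> (x - z) = 0}"

text \<open>The circle \<open>circle3 z r n\<close> is a (genuine) discrete curvature circle at the edge from
  \<open>\<gamma> i\<close> to \<open>\<gamma> (i + 1)\<close>. If one of the four points is at infinity there is none, and the frame
  (whose normal points towards the center) does not exist either.\<close>

definition discrete_curvature_circle ::
    "(int \<Rightarrow> real^3) \<Rightarrow> int \<Rightarrow> real^3 \<Rightarrow> real \<Rightarrow> real^3 \<Rightarrow> bool"
  where "discrete_curvature_circle \<gamma> i z r n \<longleftrightarrow>
    (let a = \<gamma> (i - 1); b = \<gamma> i; c = \<gamma> (i + 1); d = \<gamma> (i + 2) in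
      f_defined d a b c \<and> f_defined a b c d \<and> f_defined b c d a \<and> f_defined c d a b \<and>
      r > 0 \<and> norm n = 1 \<and>
      {f_point d a b c, f_point a b c d, f_point b c d a, f_point c d a b}
        \<subseteq> Some ` circle3 z r n)"

text \<open>Direction of traversal: \<open>T\<close> forms an acute angle with the edge vector
  \<open>\<gamma> (i + 1) - \<gamma> i\<close>.\<close>

definition discrete_frenet_frame ::
    "(int \<Rightarrow> real^3) \<Rightarrow> int \<Rightarrow> real^3 \<Rightarrow> real^3 \<Rightarrow> real^3 \<Rightarrow> bool"
  where "discrete_frenet_frame \<gamma> i T N B \<longleftrightarrow>
    (\<exists>z r n p. discrete_curvature_circle \<gamma> i z r n \<and>
      f_point (\<gamma> (i - 1)) (\<gamma> i) (\<gamma> (i + 1)) (\<gamma> (i + 2)) = Some p \<and>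
      norm T = 1 \<and> T \<bullet> n = 0 \<and> T \<bullet> (p - z) = 0 \<and> T \<bullet> (\<gamma> (i + 1) - \<gamma> i) > 0 \<and>
      N = sgn (z - p) \<and>
      B = T \<times> N)"


section \<open>Smooth space curves\<close>

definition curve_deriv :: "(real \<Rightarrow> real^3) \<Rightarrow> real \<Rightarrow> real^3"
  where "curve_deriv s t = vector_derivative s (at t)"

definition C_k_curve :: "nat \<Rightarrow> (real \<Rightarrow> real^3) \<Rightarrow> bool"
  where "C_k_curve k s \<longleftrightarrow>
    (\<forall>j<k. \<forall>t. (curve_deriv ^^ j) s differentiable (at t)) \<and>
    continuous_on UNIV ((curve_deriv ^^ k) s)"

definition regular_curve :: "(real \<Rightarrow> real^3) \<Rightarrow> bool"
  where "regular_curve s \<longleftrightarrow> (\<forall>t. curve_deriv s t \<noteq> 0)"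

definition curvature :: "(real \<Rightarrow> real^3) \<Rightarrow> real \<Rightarrow> real"
  where "curvature s t =
    norm (curve_deriv s t \<times> curve_deriv (curve_deriv s) t) / norm (curve_deriv s t) ^ 3"

definition frenet_T :: "(real \<Rightarrow> real^3) \<Rightarrow> real \<Rightarrow> real^3"
  where "frenet_T s t = curve_deriv s t /\<^sub>R norm (curve_deriv s t)"

definition frenet_B :: "(real \<Rightarrow> real^3) \<Rightarrow> real \<Rightarrow> real^3"
  where "frenet_B s t =
    (curve_deriv s t \<times> curve_deriv (curve_deriv s) t)
      /\<^sub>R norm (curve_deriv s t \<times> curve_deriv (curve_deriv s) t)"

definition frenet_N :: "(real \<Rightarrow> real^3) \<Rightarrow> real \<Rightarrow> real^3"
  where "frenet_N s t = frenet_B s t \<times> frenet_T s t"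

definition sampled_curve :: "(real \<Rightarrow> real^3) \<Rightarrow> real \<Rightarrow> real \<Rightarrow> int \<Rightarrow> real^3"
  where "sampled_curve s u \<epsilon> k = s (u + (2 * of_int k - 1) * \<epsilon>)"

end

theory Submission
  imports Defs
begin

text \<open>The argument separates a piece of inversive geometry from a parity argument.

  \<^bold>\<open>Geometry.\<close> Write \<open>\<iota>\<close> for the inversion \<open>v \<mapsto> v / |v|\<^sup>2\<close> and \<open>m x y\<close> for the vector that bisects
  the angle of \<open>x\<close> and \<open>y\<close> and has length \<open>sqrt (|x| |y|)\<close>. In a plane identified with the complex
  numbers, \<open>m x y\<close> is the square root of \<open>x y\<close> on the side of \<open>x\<close> and \<open>y\<close>. After inversion at \<open>c\<close>,
  which sends the other points to \<open>a'\<close>, \<open>b'\<close>, \<open>d'\<close>, the quaternionic formula reads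
  \<open>f(a,b,c,d)' = b' + m (b' - a') (b' - d')\<close> (\<open>f_point_via_third\<close>). So \<open>f(a,b,c,d)\<close> is
  a fixed point of the Moebius involution that swaps \<open>b\<close> with \<open>c\<close> and \<open>a\<close> with \<open>d\<close>. Inverting at \<open>d\<close>
  instead gives the second description \<open>f_point_via_fourth\<close>; together they show that \<open>f\<close> is
  invariant under swapping the outer arguments, swapping the inner ones, and hence under
  reversal. They also put all four points into a single inverted picture, where they are
  \<open>a' \<plusminus> h\<close> and \<open>c' \<plusminus> k\<close> with explicit \<open>h\<close> and \<open>k\<close>. The two involutions commute, so the pairs
  are harmonic (\<open>four_points_harmonic\<close>): inverting once more at \<open>Y = p\<^sub>b\<^sub>c\<close> sends \<open>p\<^sub>d\<^sub>a\<close> to the midpoint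
  of the images \<open>x\<close>, \<open>z\<close> of \<open>p\<^sub>a\<^sub>b\<close>, \<open>p\<^sub>c\<^sub>d\<close>. The four points therefore lie on a circle as soon as
  \<open>x\<close> and \<open>z\<close> are linearly independent; the circle is unique, it is the inverse of the line
  through \<open>x\<close> and \<open>z\<close>, its tangent at \<open>Y\<close> is parallel to \<open>z - x\<close>, and its plane has the normal
  \<open>z \<times> x\<close> (\<open>discrete_frenet_frame_iff\<close>).

  \<^bold>\<open>Asymptotics.\<close> Shifted by \<open>s(u)\<close> and divided by \<open>\<epsilon> |s'(u)|\<close>, the four samples lie near
  \<open>t v + \<epsilon> t\<^sup>2 w\<close> with \<open>t = -3, -1, 1, 3\<close>, where \<open>v = T\<close> is the unit tangent and \<open>w\<close> is proportional to \<open>s''(u)\<close>. Every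
  construction above is smooth at the limiting collinear configuration, except that \<open>p\<^sub>d\<^sub>a\<close>
  escapes to infinity; but the frame is computed from \<open>x\<close> and \<open>z\<close> alone. The limit has
  \<open>p\<^sub>a\<^sub>b, p\<^sub>b\<^sub>c, p\<^sub>c\<^sub>d\<close> at the parameters \<open>-\<surd>3, 0, \<surd>3\<close>, and to first order they still lie on the same
  parabola (\<open>near_line_four_points\<close>). Hence \<open>z - x\<close> tends to a positive multiple of \<open>v\<close>, and
  \<open>(z \<times> x) / \<epsilon>\<close> to a positive multiple of \<open>v \<times> w\<close>, which is the direction of \<open>B\<close>.

  \<^bold>\<open>Parity.\<close> Replacing \<open>\<epsilon>\<close> by \<open>-\<epsilon>\<close> negates the scaled samples and reverses their order. By
  reversal symmetry of \<open>f\<close> this maps \<open>(x, z)\<close> to \<open>(-z, -x)\<close>, so \<open>z - x\<close> and \<open>(z \<times> x) / \<epsilon>\<close> are even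
  functions of \<open>\<epsilon>\<close>. An even function with an expansion to second order differs from its limit
  by \<open>O(\<epsilon>\<^sup>2)\<close> (\<open>even_expansion\<close>), and nothing beyond the limits has to be computed.\<close>

section \<open>Inversion and geometric-mean bisectors\<close>

definition inversion :: "'a::real_normed_vector \<Rightarrow> 'a"
  where "inversion v = v /\<^sub>R (norm v)\<^sup>2"

definition mean_bisector :: "'a::real_normed_vector \<Rightarrow> 'a \<Rightarrow> 'a"
  where "mean_bisector x y = sqrt (norm x * norm y) *\<^sub>R sgn (sgn x + sgn y)"

text \<open>For nonzero arguments: \<open>x\<close> and \<open>y\<close> point in opposite directions, so that no bisecting direction
  is distinguished. This is the case that the condition on the cross-ratio excludes.\<close>

definition opposed :: "'a::real_normed_vector \<Rightarrow> 'a \<Rightarrow> bool"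
  where "opposed x y \<longleftrightarrow> sgn x + sgn y = 0"

lemma inversion_0 [simp]: "inversion 0 = 0" by (simp add: inversion_def)

lemma inversion_eq_0_iff [simp]: "inversion v = 0 \<longleftrightarrow> v = 0" by (simp add: inversion_def)

lemma norm_inversion: "norm (inversion v) = inverse (norm v)"
  by (cases "v = 0") (simp_all add: inversion_def power2_eq_square)

lemma inversion_inversion [simp]: "inversion (inversion v) = v"
  by (cases "v = 0") (simp_all add: inversion_def power2_eq_square field_simps)

lemma inversion_inject [simp]: "inversion v = inversion w \<longleftrightarrow> v = w"
  by (metis inversion_inversion)

lemma inversion_scaleR: "inversion (r *\<^sub>R v) = inverse r *\<^sub>R inversion v"
proof (cases "r = 0")
  case False
  have "inverse ((norm (r *\<^sub>R v))\<^sup>2) * r = inverse r * inverse ((norm v)\<^sup>2)"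
    using False by (simp add: power_mult_distrib power2_eq_square[of r])
  then show ?thesis by (simp add: inversion_def)
qed simp

lemma inversion_minus [simp]: "inversion (- v) = - inversion v"
  by (simp add: inversion_def)

lemma mean_bisector_commute: "mean_bisector x y = mean_bisector y x"
  by (simp add: mean_bisector_def add.commute mult.commute)

lemma mean_bisector_scaleR: "mean_bisector (r *\<^sub>R x) (r *\<^sub>R y) = r *\<^sub>R mean_bisector x y"
proof -
  have "sgn (r *\<^sub>R x) + sgn (r *\<^sub>R y) = sgn r *\<^sub>R (sgn x + sgn y)"
    by (simp add: sgn_scaleR scaleR_add_right)
  moreover have "norm (r *\<^sub>R x) * norm (r *\<^sub>R y) = r\<^sup>2 * (norm x * norm y)"
    by (simp add: power2_eq_square)
  then have "sqrt (norm (r *\<^sub>R x) * norm (r *\<^sub>R y)) = \<bar>r\<bar> * sqrt (norm x * norm y)"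
    by (simp only: real_sqrt_mult real_sqrt_abs)
  ultimately show ?thesis
    unfolding mean_bisector_def by (simp add: sgn_scaleR abs_sgn[of r] mult_ac)
qed

lemma opposed_commute: "opposed x y \<longleftrightarrow> opposed y x"
  by (simp add: opposed_def add.commute)

lemma opposed_scaleR: "r \<noteq> 0 \<Longrightarrow> opposed (r *\<^sub>R x) (r *\<^sub>R y) \<longleftrightarrow> opposed x y"
proof -
  have "sgn (r *\<^sub>R x) + sgn (r *\<^sub>R y) = sgn r *\<^sub>R (sgn x + sgn y)"
    by (simp add: sgn_scaleR scaleR_add_right)
  then show "r \<noteq> 0 \<Longrightarrow> ?thesis" by (simp add: opposed_def sgn_zero_iff)
qed

lemma imq_simps: "imq (x + y) = imq x + imq y" "imq (x - y) = imq x - imq y" "imq (- x) = - imq x"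
   "imq (r *\<^sub>R x) = r *\<^sub>R imq x" "norm (imq x) = norm x" "imq 0 = 0" "qim (imq x) = x" "qre (imq x) = 0"
  by (simp_all add: quat_eq_iff imq_def norm_quat_def)

lemma imq_inject [simp]: "imq x = imq y \<longleftrightarrow> x = y" by (simp add: imq_def)

lemma imq_0_iff [simp]: "imq x = 0 \<longleftrightarrow> x = 0" by (simp add: imq_def quat_eq_iff)

lemma inverse_imq: "inverse (imq v) = - imq (inversion v)"
  by (simp add: inverse_quat_def inversion_def quat_eq_iff imq_simps divide_inverse)

text \<open>Adding \<open>1\<close> to a unit quaternion halves its polar angle and keeps its axis, because
  \<open>1 + cos \<phi> = 2 (cos (\<phi>/2))\<^sup>2\<close> and \<open>sin \<phi> = 2 sin (\<phi>/2) cos (\<phi>/2)\<close>. This removes the angles from the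
  square root.\<close>

lemma qsqrt_eq_bisector:
  assumes "q \<notin> of_real ` {..<0}" "q \<noteq> 0"
  shows "qsqrt q = sqrt (norm q) *\<^sub>R sgn (sgn q + 1)"
proof -
  define t where "t = qre q / norm q"
  define \<phi> where "\<phi> = arccos t"
  have nq: "norm q > 0" using assms by simp
  have nsq: "(norm q)\<^sup>2 = (qre q)\<^sup>2 + (norm (qim q))\<^sup>2"
    by (simp add: norm_quat_def)
  have "\<bar>qre q\<bar> \<le> norm q"
    by (simp add: norm_quat_def real_le_rsqrt)
  then have t: "-1 \<le> t" "t \<le> 1"
    using nq by (auto simp: t_def field_simps)
  have "t \<noteq> -1"
  proof
    assume "t = -1"
    then have "qre q = - norm q" using nq by (simp add: t_def field_simps)
    then have "norm (qim q) = 0" using nsq by simp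
    then have "q = of_real (- norm q)"
      using \<open>qre q = - norm q\<close> by (simp add: quat_eq_iff of_real_def one_quat_def)
    then show False using assms nq by (metis image_eqI lessThan_iff neg_less_0_iff_less)
  qed
  then have t': "-1 < t" using t by simp
  have c: "cos \<phi> = t" using t by (simp add: \<phi>_def)
  have ph: "0 \<le> \<phi>" "\<phi> < pi"
    using t t' arccos_lbound[of t] arccos_less_mono[of t "-1"] by (auto simp: \<phi>_def)
  have cp: "cos (\<phi>/2) > 0" using ph by (intro cos_gt_zero_pi) auto
  have s: "sin \<phi> = norm (qim q) / norm q"
  proof -
    have "(norm (qim q))\<^sup>2 = (norm q)\<^sup>2 * (1 - t\<^sup>2)"
      using nsq nq by (simp add: t_def power_divide right_diff_distrib)
    then have "(norm (qim q) / norm q)\<^sup>2 = (sin \<phi>)\<^sup>2"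
      using nq c by (simp add: sin_squared_eq power_divide)
    then show ?thesis using ph sin_ge_zero[of \<phi>] by (metis divide_nonneg_nonneg less_eq_real_def norm_ge_zero power2_eq_iff_nonneg)
  qed
  define e where "e = Quat (cos (\<phi>/2)) (sin (\<phi>/2) *\<^sub>R sgn (qim q))"
  have 1: "sgn q + 1 = (2 * cos (\<phi>/2)) *\<^sub>R e"
  proof -
    have "qre (sgn q + 1) = 1 + cos \<phi>" using c by (simp add: sgn_quat_def one_quat_def t_def field_simps)
    also have "\<dots> = 2 * cos (\<phi>/2) * cos (\<phi>/2)"
      using cos_double_cos[of "\<phi>/2"] by (simp add: power2_eq_square)
    finally have a: "qre (sgn q + 1) = qre ((2 * cos (\<phi>/2)) *\<^sub>R e)" by (simp add: e_def)
    have "qim (sgn q + 1) = sin \<phi> *\<^sub>R sgn (qim q)" using s by (simp add: sgn_quat_def one_quat_def sgn_div_norm field_simps)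
    also have "sin \<phi> = 2 * cos (\<phi>/2) * sin (\<phi>/2)" using sin_double[of "\<phi>/2"] by simp
    finally show ?thesis using a by (simp add: quat_eq_iff e_def)
  qed
  have ne: "norm e = 1"
  proof (cases "qim q = 0")
    case True
    then have "sin \<phi> = 0" using s by simp
    then have "\<phi> = 0" using ph sin_gt_zero[of \<phi>] by force
    then show ?thesis by (simp add: e_def norm_quat_def)
  next
    case False
    then show ?thesis by (simp add: e_def norm_quat_def norm_sgn power_mult_distrib)
  qed
  have "sgn (sgn q + 1) = e" unfolding 1 using cp ne by (simp add: sgn_div_norm)
  then show ?thesis by (simp add: qsqrt_def Let_def e_def \<phi>_def t_def)
qed

lemma negative_real_quat_iff: "q \<in> of_real ` {..<0} \<longleftrightarrow> sgn q = - (1::quat)"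
proof
  assume "sgn q = -1"
  then have "q = of_real (- norm q)" "q \<noteq> 0"
    by (auto simp: sgn_quat_def of_real_def) (metis scaleR_minus_right scaleR_one scaleR_scaleR norm_eq_zero right_inverse scaleR_zero_left)
  then show "q \<in> of_real ` {..<0}" by (metis image_eqI lessThan_iff neg_less_0_iff_less zero_less_norm_iff)
qed (auto simp: sgn_of_real)

text \<open>Left multiplication by \<open>x\<close> scales norms by \<open>|x|\<close> and carries \<open>q\<close> to \<open>y\<close>, hence \<open>sgn q + 1\<close> to \<open>|x|\<close> times \<open>sgn x + sgn y\<close>.
  Thus it turns the bisector of \<open>q\<close> and \<open>1\<close> into the bisector of \<open>y\<close> and \<open>x\<close>, and the product of a
  vector with a quaternionic square root is again a vector.\<close>

lemma imq_qsqrt: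
  fixes x y :: "real^3"
  assumes "x \<noteq> 0" "y \<noteq> 0"
  defines "q \<equiv> inverse (imq x) * imq y"
  shows "q \<in> of_real ` {..<0} \<longleftrightarrow> opposed x y"
    and "\<not> opposed x y \<Longrightarrow> imq x * qsqrt q = imq (mean_bisector x y)"
proof -
  have nx: "imq x \<noteq> 0" using assms by simp
  have nq: "norm q = norm y / norm x" by (simp add: q_def norm_mult norm_inverse imq_simps divide_inverse mult.commute)
  have xq: "imq x * q = imq y" using nx by (simp add: q_def mult.assoc[symmetric])
  have "imq x * (sgn q + 1) = norm x *\<^sub>R imq (sgn x + sgn y)"
    using assms(1,2) by (simp add: sgn_quat_def distrib_left xq[unfolded q_def] nq[unfolded q_def] q_def imq_simps sgn_div_norm scaleR_add_right divide_inverse)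
  then have k: "sgn q + 1 = norm x *\<^sub>R (inverse (imq x) * imq (sgn x + sgn y))"
    using nx by (metis mult.assoc left_inverse mult_1 mult_scaleR_right)
  have "sgn q = -1 \<longleftrightarrow> sgn q + 1 = 0" by (simp add: eq_neg_iff_add_eq_0)
  also have "\<dots> \<longleftrightarrow> opposed x y" using assms(1,2) by (simp add: k opposed_def)
  finally show iff: "q \<in> of_real ` {..<0} \<longleftrightarrow> opposed x y" by (simp add: negative_real_quat_iff)
  assume no: "\<not> opposed x y"
  have "norm (sgn q + 1) = norm (sgn x + sgn y)"
    using assms(1,2) by (simp add: k norm_mult norm_inverse imq_simps(5))
  then have "sgn (sgn q + 1) = (norm x / norm (sgn x + sgn y)) *\<^sub>R (inverse (imq x) * imq (sgn x + sgn y))"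
    by (simp add: sgn_quat_def[of "sgn q + 1"]) (simp add: k divide_inverse)
  then have "imq x * sgn (sgn q + 1) = norm x *\<^sub>R imq (sgn (sgn x + sgn y))"
    using nx by (simp add: mult.assoc[symmetric] sgn_div_norm[of "sgn x + sgn y"] imq_simps(4) divide_inverse)
  moreover have "qsqrt q = sqrt (norm q) *\<^sub>R sgn (sgn q + 1)"
    using no iff assms(1,2) by (intro qsqrt_eq_bisector) (auto simp: q_def)
  ultimately have "imq x * qsqrt q = (sqrt (norm y / norm x) * norm x) *\<^sub>R imq (sgn (sgn x + sgn y))"
    by (simp add: nq)
  also have "sqrt (norm y / norm x) * norm x = sqrt (norm x * norm y)"
    using assms(1,2) real_sqrt_mult_self[of "norm x"] by (simp add: real_sqrt_divide real_sqrt_mult field_simps)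
  finally show "imq x * qsqrt q = imq (mean_bisector x y)" by (simp add: mean_bisector_def imq_simps)
qed

section \<open>Quaternionic points as bisectors in inverted coordinates\<close>

text \<open>The point whose image under inversion at \<open>c\<close> is \<open>y\<close>; the centre itself is the image of the point
  at infinity.\<close>

definition from_inverted :: "real^3 \<Rightarrow> real^3 \<Rightarrow> (real^3) option"
  where "from_inverted c y = (if y = 0 then None else Some (c + inversion y))"

lemma inverse_diff_cancel:
  fixes x y :: "'a::division_ring"
  assumes "x \<noteq> 0" "y \<noteq> 0"
  shows "inverse x - inverse y = inverse x * (y - x) * inverse y"
  using assms by (simp add: algebra_simps)

text \<open>Since \<open>p = (w + 1)\<^sup>-\<^sup>1 (w c + b)\<close> gives \<open>(p - c)\<^sup>-\<^sup>1 = (b - c)\<^sup>-\<^sup>1 (w + 1)\<close>, inversion at \<open>c\<close> makes the formula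
  affine in \<open>w\<close>. There the cross-ratio becomes the quotient \<open>x\<^sup>-\<^sup>1 y\<close> of the difference vectors, to which
  \<open>imq_qsqrt\<close> applies. The quaternionic inverse of a vector is minus its inversion, which affects all
  terms alike.\<close>

lemma f_point_via_third:
  assumes "distinct [a, b, c, d]"
  defines "x \<equiv> inversion (b - c) - inversion (a - c)"
    and "y \<equiv> inversion (b - c) - inversion (d - c)"
  shows "f_defined a b c d \<longleftrightarrow> \<not> opposed x y"
    and "f_defined a b c d \<Longrightarrow>
      f_point a b c d = from_inverted c (inversion (b - c) + mean_bisector x y)"
proof -
  define A B C D where "A = imq a" and "B = imq b" and "C = imq c" and "D = imq d"
  note ABCD = A_def B_def C_def D_def
  have xy: "x \<noteq> 0" "y \<noteq> 0" using assms by auto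
  have ne: "A \<noteq> B" "A \<noteq> C" "B \<noteq> C" "B \<noteq> D" "C \<noteq> D" "A \<noteq> D"
    using assms by (auto simp: ABCD)
  have iv: "inverse (imq v - imq c) = - imq (inversion (v - c))" for v
    using inverse_imq[of "v - c"] by (simp only: imq_simps(2))
  have X: "imq x = - (inverse (B - C) - inverse (A - C))"
    by (simp only: x_def ABCD imq_simps iv) simp
  have Y: "imq y = - (inverse (B - C) - inverse (D - C))"
    by (simp only: y_def ABCD imq_simps iv) simp
  have X': "imq x = inverse (B - C) * (B - A) * inverse (A - C)"
    unfolding X using ne inverse_diff_cancel[of "B - C" "A - C"]
    by (simp flip: minus_mult_left minus_mult_right) (metis minus_diff_eq mult_minus_left mult_minus_right)
  have Y': "imq y = inverse (B - C) * (B - D) * inverse (D - C)"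
    unfolding Y using ne inverse_diff_cancel[of "B - C" "D - C"]
    by (simp flip: minus_mult_left minus_mult_right) (metis minus_diff_eq mult_minus_left mult_minus_right)
  define q where "q = cross_ratio C A B D"
  have i1: "inverse (B - A) = - inverse (A - B)" using inverse_minus_eq[of "A - B"] by simp
  have i2: "inverse (C - A) = - inverse (A - C)" using inverse_minus_eq[of "A - C"] by simp
  have "inverse (imq x) * imq y = (A - C) * inverse (B - A) * (B - C) * (inverse (B - C) * (B - D) * inverse (D - C))"
    using ne by (simp add: X' Y' nonzero_inverse_mult_distrib mult.assoc)
  also have "\<dots> = (A - C) * inverse (B - A) * ((B - C) * inverse (B - C)) * (B - D) * inverse (D - C)"
    by (simp only: mult.assoc)
  also have "\<dots> = q"
  proof -
    have "A - C = - (C - A)" by simp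
    then show ?thesis
      using ne by (simp only: q_def cross_ratio_def i1 right_inverse right_minus_eq minus_mult_minus simp_thms mult_1_right not_False_eq_True)
  qed
  finally have q: "q = inverse (imq x) * imq y" by simp
  show D: "f_defined a b c d \<longleftrightarrow> \<not> opposed x y"
    using assms(1) imq_qsqrt(1)[OF xy] by (auto simp: f_defined_def q_def[symmetric] ABCD[symmetric] q)
  assume "f_defined a b c d"
  then have m: "imq x * qsqrt q = imq (mean_bisector x y)"
    using D imq_qsqrt(2)[OF xy] by (simp add: q)
  define w where "w = f_coeff a b c d"
  define v where "v = inversion (b - c) + mean_bisector x y"
  have "w = (B - A) * inverse (C - A) * qsqrt q"
    by (simp add: w_def f_coeff_def q_def ABCD)
  also have "(B - A) * inverse (C - A) = - ((B - C) * imq x)"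
    using ne by (simp add: X' i2 mult.assoc[symmetric])
  finally have w: "w = - ((B - C) * imq (mean_bisector x y))"
    by (simp add: m[symmetric] mult.assoc)
  have "imq (inversion (b - c)) = - inverse (B - C)"
    using iv[of b] by (simp add: ABCD)
  then have "(B - C) * imq (inversion (b - c)) = - 1"
    using ne by simp
  then have w1: "w + 1 = - ((B - C) * imq v)"
    by (simp add: w v_def imq_simps distrib_left)
  then have w0: "w + 1 = 0 \<longleftrightarrow> v = 0" using ne by simp
  show "f_point a b c d = from_inverted c v"
  proof (cases "v = 0")
    case True
    then show ?thesis using w0 by (simp add: f_point_def from_inverted_def Let_def w_def)
  next
    case False
    have "inverse (w + 1) * (w * C + B) = inverse (w + 1) * ((w + 1) * C + (B - C))"
      by (simp add: algebra_simps)
    also have "\<dots> = C + inverse (w + 1) * (B - C)"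
      using False w0 by (simp only: distrib_left[of "inverse (w + 1)" "(w + 1) * C"] mult.assoc[symmetric]
          left_inverse simp_thms not_False_eq_True mult_1_left)
    also have "inverse (w + 1) * (B - C) = imq (inversion v)"
      using ne False by (simp add: w1 nonzero_inverse_mult_distrib mult.assoc inverse_imq)
    finally show ?thesis
      using False w0 by (simp add: f_point_def from_inverted_def Let_def w_def ABCD imq_simps)
  qed
qed

text \<open>The quaternion product \<open>c x c\<close> of imaginary \<open>c\<close> and \<open>x\<close>: the reflection in the plane orthogonal
  to \<open>c\<close>, scaled by \<open>|c|\<^sup>2\<close>. It is a similarity, so it commutes with bisectors, and it describes
  how the inversive coordinate changes when the centre of inversion is moved.\<close>

definition reflect :: "'a::real_inner \<Rightarrow> 'a \<Rightarrow> 'a"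
  where "reflect c x = (norm c)\<^sup>2 *\<^sub>R x - (2 * (c \<bullet> x)) *\<^sub>R c"

lemma reflect_linear: "reflect c (x + y) = reflect c x + reflect c y"
   "reflect c (x - y) = reflect c x - reflect c y" "reflect c (r *\<^sub>R x) = r *\<^sub>R reflect c x"
  "reflect c (- x) = - reflect c x"
  by (simp_all add: reflect_def inner_simps algebra_simps)

lemma reflect_0 [simp]: "reflect c 0 = 0" by (simp add: reflect_def)

lemma norm_reflect: "norm (reflect c x) = (norm c)\<^sup>2 * norm x"
proof -
  have "(norm (reflect c x))\<^sup>2 = ((norm c)\<^sup>2 * norm x)\<^sup>2"
    unfolding power_mult_distrib power2_norm_eq_inner reflect_def
    by (simp add: inner_simps inner_commute power2_eq_square algebra_simps)
  then show ?thesis by (simp add: power2_eq_iff_nonneg)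
qed

lemma reflect_self: "c \<noteq> 0 \<Longrightarrow> reflect c (inversion c) = - c"
  by (simp add: reflect_def inversion_def power2_norm_eq_inner scaleR_2)

lemma sgn_reflect: "c \<noteq> 0 \<Longrightarrow> sgn (reflect c x) = reflect c (sgn x) /\<^sub>R (norm c)\<^sup>2"
  by (simp add: sgn_div_norm norm_reflect reflect_linear)

lemma sgn_add_reflect: "c \<noteq> 0 \<Longrightarrow>
    sgn (reflect c x) + sgn (reflect c y) = reflect c (sgn x + sgn y) /\<^sub>R (norm c)\<^sup>2"
  by (simp add: sgn_reflect reflect_linear scaleR_add_right)

lemma mean_bisector_reflect: "mean_bisector (reflect c x) (reflect c y) = reflect c (mean_bisector x y)"
proof (cases "c = 0")
  case False
  have "sqrt (norm (reflect c x) * norm (reflect c y)) = (norm c)\<^sup>2 * sqrt (norm x * norm y)"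
    using real_sqrt_mult_self[of "(norm c)\<^sup>2"] by (simp add: norm_reflect real_sqrt_mult power2_eq_square)
  moreover have "sgn (reflect c z /\<^sub>R (norm c)\<^sup>2) = reflect c (sgn z) /\<^sub>R (norm c)\<^sup>2" for z
    using False by (simp add: sgn_reflect sgn_scaleR)
  ultimately show ?thesis
    using False by (simp add: mean_bisector_def sgn_add_reflect reflect_linear(3))
qed (simp add: mean_bisector_def reflect_def)

lemma opposed_reflect: "c \<noteq> 0 \<Longrightarrow> opposed (reflect c x) (reflect c y) \<longleftrightarrow> opposed x y"
  using norm_reflect[of c "sgn x + sgn y"] by (auto simp: opposed_def sgn_add_reflect)

text \<open>The vector form of the identity \<open>(x\<^sup>-\<^sup>1 - y\<^sup>-\<^sup>1)\<^sup>-\<^sup>1 = y (y - x)\<^sup>-\<^sup>1 y - y\<close> in a division ring. Read with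
  \<open>x\<close>, \<open>y\<close> as coordinates in an inverted picture, it says that passing to the inversion at the
  point with coordinate \<open>y\<close> is again an inversion, up to a similarity and a translation.\<close>

lemma inversion_diff_inversion:
  assumes "x \<noteq> 0" "y \<noteq> 0" "x \<noteq> y"
  shows "inversion (inversion x - inversion y) = reflect y (inversion (x - y)) - y"
proof -
  define p q r where "p = x \<bullet> x" "q = y \<bullet> y" "r = x \<bullet> y"
  have nz: "p \<noteq> 0" "q \<noteq> 0" "p - 2 * r + q \<noteq> 0" 
    using assms inner_eq_zero_iff[of "x - y"] by (auto simp: p_q_r_def inner_simps inner_commute)
  have n2: "(norm (inversion x - inversion y))\<^sup>2 = (p - 2 * r + q) / (p * q)"
    using nz unfolding power2_norm_eq_inner 
    by (simp add: inversion_def power2_norm_eq_inner p_q_r_def[symmetric] inner_simps inner_commute field_simps)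
  have n3: "(norm (x - y))\<^sup>2 = p - 2 * r + q"
    by (simp add: power2_norm_eq_inner inner_simps inner_commute p_q_r_def)
  have "inversion (inversion x - inversion y) = (p * q / (p - 2 * r + q)) *\<^sub>R ((1 / p) *\<^sub>R x - (1 / q) *\<^sub>R y)"
    by (subst inversion_def, subst n2) (simp add: inversion_def power2_norm_eq_inner p_q_r_def divide_inverse)
  also have "\<dots> = (q / (p - 2 * r + q)) *\<^sub>R x - (p / (p - 2 * r + q)) *\<^sub>R y"
    using nz by (simp add: scaleR_diff_right)
  also have "p / (p - 2 * r + q) = (q + 2 * (r - q)) / (p - 2 * r + q) + 1"
    using nz by (simp add: field_simps)
  also have "(q / (p - 2 * r + q)) *\<^sub>R x - ((q + 2 * (r - q)) / (p - 2 * r + q) + 1) *\<^sub>R y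
     = reflect y (inversion (x - y)) - y"
    by (simp add: reflect_def inversion_def n3 power2_norm_eq_inner[of y] p_q_r_def[symmetric] inner_simps
       inner_commute[of y x] scaleR_diff_right scaleR_add_left add_divide_distrib algebra_simps divide_inverse)
      (simp flip: scaleR_add_left)
  finally show ?thesis .
qed

section \<open>Planar configurations in the complex plane\<close>

text \<open>All identities between inversions and bisectors below involve only two independent vectors, so
  they can be checked in the complex plane, where bisectors are square roots of products.\<close>

lemma complex_plane_through_two_vectors:
  fixes x y :: "real^3"
  obtains L :: "complex \<Rightarrow> real^3"
    where "linear L" "\<And>z. norm (L z) = norm z" "x \<in> range L" "y \<in> range L"
proof -
  obtain e where e: "norm e = 1" "\<exists>r. x = r *\<^sub>R e"
  proof (cases "x = 0")
    case True
    then show ?thesis using that[of "axis 1 1"] by (auto intro: exI[of _ 0])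
  next
    case False
    then have "x = norm x *\<^sub>R sgn x" by (simp add: sgn_div_norm)
    then show ?thesis using that[of "sgn x"] False by (auto simp: norm_sgn)
  qed
  obtain f where f: "norm f = 1" "e \<bullet> f = 0" "\<exists>r. y - (y \<bullet> e) *\<^sub>R e = r *\<^sub>R f"
  proof (cases "y - (y \<bullet> e) *\<^sub>R e = 0")
    case True
    obtain f where "f \<noteq> 0" "orthogonal e f"
      using orthogonal_to_vector_exists[of e] by auto
    then show ?thesis using that[of "sgn f"] True
      by (simp add: norm_sgn orthogonal_def) (simp add: sgn_div_norm)
  next
    case False
    define g where "g = y - (y \<bullet> e) *\<^sub>R e"
    have "e \<bullet> g = 0"
      using e by (simp add: g_def inner_diff_right inner_commute norm_eq_1)
    then have "e \<bullet> sgn g = 0" by (simp add: sgn_div_norm)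
    moreover have "g = norm g *\<^sub>R sgn g" "norm (sgn g) = 1"
      using False by (simp_all add: sgn_div_norm flip: g_def)
    ultimately show ?thesis
      using that[of "sgn g"] unfolding g_def[symmetric] by blast
  qed
  define L where "L z = Re z *\<^sub>R e + Im z *\<^sub>R f" for z
  show ?thesis
  proof
    show "linear L" by (rule linearI) (simp_all add: L_def algebra_simps)
    show "norm (L z) = norm z" for z
      using e f by (simp add: L_def norm_eq_sqrt_inner[of "_ + _"] cmod_def inner_simps inner_commute norm_eq_1 power2_eq_square)
    obtain r where "x = r *\<^sub>R e" using e by blast
    then have "x = L (Complex r 0)" by (simp add: L_def)
    then show "x \<in> range L" by blast
    obtain r where "y - (y \<bullet> e) *\<^sub>R e = r *\<^sub>R f" using f by blast
    then have "y = L (Complex (y \<bullet> e) r)" by (simp add: L_def algebra_simps)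
    then show "y \<in> range L" by blast
  qed
qed

locale isometric_embedding =
  fixes L :: "'a::real_normed_vector \<Rightarrow> 'b::real_normed_vector"
  assumes linear: "linear L" and norm: "norm (L x) = norm x"
begin

lemmas L_simps = linear_add[OF linear, symmetric] linear_diff[OF linear, symmetric]
  linear_scale[OF linear, symmetric] linear_neg[OF linear, symmetric]

lemma sgn: "sgn (L x) = L (sgn x)"
  by (simp add: sgn_div_norm norm L_simps)

lemma inversion: "inversion (L x) = L (inversion x)"
  by (simp add: inversion_def norm L_simps)

lemma mean_bisector: "mean_bisector (L x) (L y) = L (mean_bisector x y)"
  by (simp add: mean_bisector_def norm L_simps sgn)

lemma eq_0_iff: "L x = 0 \<longleftrightarrow> x = 0"
  by (metis norm norm_eq_zero)

lemma inject: "L x = L y \<longleftrightarrow> x = y"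
  using eq_0_iff[of "x - y"] by (simp flip: L_simps)

lemma opposed: "opposed (L x) (L y) \<longleftrightarrow> opposed x y"
  by (simp add: opposed_def sgn L_simps eq_0_iff)

end

lemma inversion_complex: "inversion z = inverse (cnj z)"
  by (simp add: inversion_def complex_eq_iff cmod_power2 divide_inverse mult.commute)

lemma complex_opposed_iff:
  fixes x y :: complex
  assumes "x \<noteq> 0" "y \<noteq> 0"
  shows "opposed x y \<longleftrightarrow> sgn (x / y) = -1"
proof -
  have "sgn (x / y) = sgn x / sgn y"
    using assms by (simp add: sgn_eq norm_divide)
  then show ?thesis
    using assms by (auto simp: opposed_def divide_eq_eq sgn_zero_iff add_eq_0_iff)
qed

text \<open>For unit complex numbers \<open>(u + v)\<^sup>2 = u v |u + v|\<^sup>2\<close>, since \<open>u v\<close> times the conjugate of \<open>u + v\<close> is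
  \<open>u + v\<close> again. The sign of the real part of the quotient by \<open>y\<close> tells the two roots apart.\<close>

lemma complex_mean_bisector_square:
  fixes x y :: complex
  assumes "\<not> opposed x y" "x \<noteq> 0" "y \<noteq> 0"
  shows "(mean_bisector x y)\<^sup>2 = x * y" and "Re (mean_bisector x y / y) > 0"
proof -
  define u v where "u = sgn x" and "v = sgn y"
  have u: "cnj u * u = 1" "cnj v * v = 1" "cmod u = 1" "cmod v = 1"
    using assms by (simp_all add: u_def v_def norm_sgn mult.commute[of "cnj _"] flip: complex_norm_square)
  have xy: "x = norm x * u" "y = norm y * v"
    using assms by (simp_all add: u_def v_def sgn_eq)
  have n0: "u + v \<noteq> 0" using assms by (simp add: opposed_def u_def v_def)
  have "(u + v)\<^sup>2 = u * v * (cnj u + cnj v) * (u + v)"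
    using u by (simp add: power2_eq_square algebra_simps) 
  also have "\<dots> = u * v * (norm (u + v))\<^sup>2"
    using complex_norm_square[of "u + v"] by (simp add: mult.assoc mult.commute)
  finally have "(sgn (u + v))\<^sup>2 = u * v"
    using n0 by (simp add: sgn_eq power_divide)
  moreover have "(mean_bisector x y)\<^sup>2 = (norm x * norm y) * (sgn (u + v))\<^sup>2"
    by (simp add: mean_bisector_def u_def v_def scaleR_conv_of_real power_mult_distrib flip: of_real_power of_real_mult)
  ultimately have "(mean_bisector x y)\<^sup>2 = (norm x * u) * (norm y * v)" by simp
  then show "(mean_bisector x y)\<^sup>2 = x * y" using xy by simp
  have "Re ((u + v) / v) > 0"
  proof -
    have v0: "v \<noteq> 0" using u by auto
    have "cmod (u / v) = 1" using u by (simp add: norm_divide)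
    moreover have "u / v \<noteq> -1" using v0 n0 by (auto simp: divide_eq_eq add_eq_0_iff)
    ultimately have "Re (u / v) > -1"
      by (smt (verit) abs_Re_le_cmod cmod_eq_Re complex.expand complex_Re_of_int  abs_square_eq_1 cmod_power2 uminus_complex.simps one_complex.simps power2_eq_1_iff power_zero_numeral zero_eq_power2)
    then show ?thesis using v0 by (simp add: add_divide_distrib)
  qed
  moreover have "mean_bisector x y / y = (sqrt (norm x * norm y) / (norm (u + v) * norm y)) *\<^sub>R ((u + v) / v)"
  proof -
    have "mean_bisector x y = (sqrt (norm x * norm y) / norm (u + v)) *\<^sub>R (u + v)"
      unfolding mean_bisector_def u_def[symmetric] v_def[symmetric]
      by (simp add: sgn_div_norm divide_inverse)
    then have "mean_bisector x y / (norm y * v) = (sqrt (norm x * norm y) / (norm (u + v) * norm y)) *\<^sub>R ((u + v) / v)"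
      by (simp add: scaleR_conv_of_real)
    then show ?thesis using xy(2) by simp
  qed
  ultimately show "Re (mean_bisector x y / y) > 0"
    using n0 assms by simp
qed

lemma complex_mean_bisector_unique:
  fixes x y :: complex
  assumes "\<not> opposed x y" "x \<noteq> 0" "y \<noteq> 0" "m\<^sup>2 = x * y" "Re (m / y) > 0"
  shows "mean_bisector x y = m"
proof -
  have "m = mean_bisector x y \<or> m = - mean_bisector x y"
    using complex_mean_bisector_square(1)[OF assms(1-3)] assms(4) power2_eq_iff[of m "mean_bisector x y"] by simp
  then show ?thesis
    using complex_mean_bisector_square(2)[OF assms(1-3)] assms(5) by auto
qed

section \<open>Symmetries of the point construction\<close>

text \<open>The bisector construction performed with centre \<open>c\<close> and the one performed with the centre at
  infinity define the same point. Put \<open>h\<^sup>2 = b c\<close>: up to conjugation the square root needed for the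
  centre \<open>c\<close> is \<open>h / (c (b - c))\<close>, with the correct sign because its quotient by \<open>1 / (b - c)\<close> is
  \<open>h / c\<close>. The claim then reduces to \<open>(c + h) (h - c) = c (b - c)\<close>.\<close>

lemma complex_mean_bisector_change_centre:
  fixes b c :: complex
  assumes "b \<noteq> 0" "c \<noteq> 0" "b \<noteq> c"
  defines "x \<equiv> inversion (b - c) + inversion c" and "y \<equiv> inversion (b - c)"
  shows "opposed x y \<longleftrightarrow> opposed b c"
    and "\<not> opposed b c \<Longrightarrow> mean_bisector b c \<noteq> c"
    and "\<not> opposed b c \<Longrightarrow> y + mean_bisector x y = inversion (mean_bisector b c - c)"
proof -
  have x: "x = cnj (b / (c * (b - c)))" and y: "y = cnj (1 / (b - c))"
    using assms(1-3) by (simp_all add: x_def y_def inversion_complex field_simps)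
  have nz: "x \<noteq> 0" "y \<noteq> 0" using assms(1-3) by (simp_all add: x y)
  have "x / y = cnj (b / c)"
    using assms(1-3) by (simp add: x y)
  then have "sgn (x / y) = cnj (sgn (b / c))"
    by (simp add: sgn_eq norm_divide)
  then show opp: "opposed x y \<longleftrightarrow> opposed b c"
    using nz assms(1-3) by (metis complex_opposed_iff complex_cnj_cnj complex_cnj_minus complex_cnj_one)
  assume no: "\<not> opposed b c"
  define h where "h = mean_bisector b c"
  have h: "h\<^sup>2 = b * c" "Re (h / c) > 0"
    using complex_mean_bisector_square[OF no assms(1,2)] by (simp_all add: h_def)
  show "mean_bisector b c \<noteq> c"
    using h assms(1-3) by (auto simp: power2_eq_square h_def)
  then have hc: "h - c \<noteq> 0" by (simp add: h_def)
  have "mean_bisector x y = cnj (h / (c * (b - c)))"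
  proof (rule complex_mean_bisector_unique)
    show "(cnj (h / (c * (b - c))))\<^sup>2 = x * y"
      using assms(1-3) h(1) by (simp add: x y power_divide power_mult_distrib flip: complex_cnj_power)
        (simp add: power2_eq_square)
    have eq: "cnj (h / (c * (b - c))) / y = cnj (h / c)"
      using assms(1-3) by (simp add: y)
    show "Re (cnj (h / (c * (b - c))) / y) > 0"
      using h(2) by (simp only: eq cnj.simps)
  qed (use no opp nz in auto)
  then have "y + mean_bisector x y = cnj ((c + h) / (c * (b - c)))"
    using assms(1-3) by (simp add: y add_divide_distrib)
  also have "(c + h) * (h - c) = c * (b - c)"
    using h(1) by (simp add: algebra_simps power2_eq_square)
  then have "(c + h) / (c * (b - c)) = 1 / (h - c)"
    using hc assms(1-3) by (simp add: divide_eq_eq eq_divide_eq)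
  finally show "y + mean_bisector x y = inversion (mean_bisector b c - c)"
    by (simp add: inversion_complex h_def divide_inverse)
qed

lemma mean_bisector_change_centre:
  fixes b c :: "real^3"
  assumes "b \<noteq> 0" "c \<noteq> 0" "b \<noteq> c"
  defines "x \<equiv> inversion (b - c) + inversion c" and "y \<equiv> inversion (b - c)"
  shows "opposed x y \<longleftrightarrow> opposed b c"
    and "\<not> opposed b c \<Longrightarrow> mean_bisector b c \<noteq> c"
    and "\<not> opposed b c \<Longrightarrow> y + mean_bisector x y = inversion (mean_bisector b c - c)"
proof -
  obtain L b' c' where "linear L" "\<And>z. norm (L z) = norm z" and bc: "b = L b'" "c = L (c' :: complex)"
    by (rule complex_plane_through_two_vectors[of b c]) (auto simp: image_iff)
  then interpret isometric_embedding L by (intro isometric_embedding.intro)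
  have "b' \<noteq> 0" "c' \<noteq> 0" "b' \<noteq> c'" using assms(1-3) by (auto simp: bc eq_0_iff)
  note c = complex_mean_bisector_change_centre[OF this]
  show "opposed x y \<longleftrightarrow> opposed b c" "\<not> opposed b c \<Longrightarrow> mean_bisector b c \<noteq> c"
    "\<not> opposed b c \<Longrightarrow> y + mean_bisector x y = inversion (mean_bisector b c - c)"
    using c by (simp_all add: x_def y_def bc L_simps opposed inversion mean_bisector inject)
qed

text \<open>All inverted vectors in \<open>f_point_via_third\<close> are images, under one scaled reflection, of vectors
  built from the inversion at \<open>d\<close>; bisectors commute with that reflection, and what remains is the
  change of centre in the plane. In contrast to \<open>f_point_via_third\<close>, the result is visibly
  symmetric in \<open>b\<close> and \<open>c\<close>.\<close>

lemma f_point_via_fourth: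
  assumes "distinct [a, b, c, d]"
  defines "A \<equiv> inversion (a - d)" and "B \<equiv> inversion (b - d)" and "C \<equiv> inversion (c - d)"
  shows "f_defined a b c d \<longleftrightarrow> \<not> opposed (B - A) (C - A)"
    and "f_defined a b c d \<Longrightarrow>
      f_point a b c d = from_inverted d (A + mean_bisector (B - A) (C - A))"
proof -
  have nz: "A \<noteq> 0" "B \<noteq> 0" "C \<noteq> 0" "A \<noteq> B" "A \<noteq> C" "B \<noteq> C"
    using assms(1) by (auto simp: A_def B_def C_def)
  have eqs: "a = d + inversion A" "b = d + inversion B" "c = d + inversion C"
    by (simp_all add: A_def B_def C_def)
  have i: "inversion (b - c) = reflect C (inversion (B - C)) - C"
      "inversion (a - c) = reflect C (inversion (A - C)) - C" "inversion (d - c) = - C"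
    using inversion_diff_inversion[of B C] inversion_diff_inversion[of A C] nz by (simp_all add: eqs)
  define b' c' where "b' = B - A" and "c' = C - A"
  have bc: "b' \<noteq> 0" "c' \<noteq> 0" "b' \<noteq> c'" using nz by (auto simp: b'_def c'_def)
  note m = mean_bisector_change_centre[OF bc]
  have "B - C = b' - c'" "A - C = - c'" by (simp_all add: b'_def c'_def)
  then have x: "inversion (b - c) - inversion (a - c) = reflect C (inversion (b' - c') + inversion c')"
    and y: "inversion (b - c) - inversion (d - c) = reflect C (inversion (b' - c'))"
    and z: "inversion (b - c) = reflect C (inversion (b' - c')) - C"
    by (simp_all add: i reflect_linear)
  note 3 = f_point_via_third[OF assms(1)]
  show D: "f_defined a b c d \<longleftrightarrow> \<not> opposed (B - A) (C - A)"
    using 3(1) nz(3) m(1) by (simp add: x y opposed_reflect b'_def c'_def)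
  assume def: "f_defined a b c d"
  define P where "P = A + mean_bisector (B - A) (C - A)"
  define v where "v = inversion (b - c) + mean_bisector (inversion (b - c) - inversion (a - c)) (inversion (b - c) - inversion (d - c))"
  have no: "\<not> opposed b' c'" using D def by (simp add: b'_def c'_def)
  have PC: "P - C = mean_bisector b' c' - c'" by (simp add: P_def b'_def c'_def)
  have v: "v = reflect C (inversion (P - C)) - C"
    unfolding PC by (simp add: m(3)[OF no, symmetric] v_def x y mean_bisector_reflect) (simp add: z reflect_linear)
  have "P \<noteq> C" using PC m(2)[OF no] by auto
  have "from_inverted c v = from_inverted d P"
  proof (cases "P = 0")
    case True
    then have "v = 0" using reflect_self[OF nz(3)] by (simp add: v reflect_linear)
    then show ?thesis using True by (simp add: from_inverted_def)
  next
    case False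
    then have "v = inversion (inversion P - inversion C)"
      using inversion_diff_inversion[of P C] nz \<open>P \<noteq> C\<close> by (simp add: v)
    then show ?thesis using False \<open>P \<noteq> C\<close> eqs(3) by (simp add: from_inverted_def)
  qed
  then show "f_point a b c d = from_inverted d (A + mean_bisector (B - A) (C - A))"
    using 3(2)[OF def] by (simp add: P_def v_def)
qed

lemma f_defined_swap_outer: "f_defined a b c d \<longleftrightarrow> f_defined d b c a"
proof (cases "distinct [a, b, c, d]")
  case True
  then have "distinct [d, b, c, a]" by auto
  then show ?thesis
    using f_point_via_third(1)[OF True] f_point_via_third(1)[of d b c a] by (simp add: opposed_commute)
qed (auto simp: f_defined_def)

lemma f_point_swap_outer: "f_defined a b c d \<Longrightarrow> f_point a b c d = f_point d b c a"
  using f_point_via_third(2)[of a b c d] f_point_via_third(2)[of d b c a] f_defined_swap_outer[of a b c d]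
  by (auto simp: mean_bisector_commute f_defined_def)

lemma f_defined_swap_inner: "f_defined a b c d \<longleftrightarrow> f_defined a c b d"
proof (cases "distinct [a, b, c, d]")
  case True
  then have "distinct [a, c, b, d]" by auto
  then show ?thesis
    using f_point_via_fourth(1)[OF True] f_point_via_fourth(1)[of a c b d] by (simp add: opposed_commute)
qed (auto simp: f_defined_def)

lemma f_point_swap_inner: "f_defined a b c d \<Longrightarrow> f_point a b c d = f_point a c b d"
  using f_point_via_fourth(2)[of a b c d] f_point_via_fourth(2)[of a c b d] f_defined_swap_inner[of a b c d]
  by (auto simp: mean_bisector_commute f_defined_def)

lemma f_defined_reverse: "f_defined a b c d \<longleftrightarrow> f_defined d c b a"
  using f_defined_swap_inner f_defined_swap_outer by blast

lemma f_point_reverse: "f_defined a b c d \<Longrightarrow> f_point a b c d = f_point d c b a"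
  using f_point_swap_inner f_point_swap_outer f_defined_swap_outer by metis

section \<open>The four points form a harmonic quadruple\<close>

text \<open>From \<open>h\<^sup>2 = b c\<close> and \<open>k\<^sup>2 = (c - b) c\<close> one gets \<open>(c - h)\<^sup>2 - k\<^sup>2 = -2 h (c - h)\<close>. This says that the
  pairs \<open>\<plusminus> h\<close> and \<open>c \<plusminus> k\<close> have cross-ratio \<open>-1\<close>, here stated as: \<open>-h\<close> is the harmonic conjugate of \<open>h\<close>
  with respect to \<open>c \<plusminus> k\<close>.\<close>

lemma complex_mean_bisectors_harmonic:
  fixes b c :: complex
  assumes "b \<noteq> 0" "c \<noteq> 0" "b \<noteq> c" "\<not> opposed b c" "\<not> opposed (c - b) c"
  defines "h \<equiv> mean_bisector b c" and "k \<equiv> mean_bisector (c - b) c"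
  shows "h \<noteq> 0" "c - k \<noteq> h" "c + k \<noteq> h"
    "inversion (c - k - h) + inversion (c + k - h) = - inversion h"
proof -
  define e where "e = c - h"
  have h: "h * h = b * c" and k: "k * k = (c - b) * c"
    using complex_mean_bisector_square(1)[of b c] complex_mean_bisector_square(1)[of "c - b" c] assms
    by (simp_all add: power2_eq_square)
  show h0: "h \<noteq> 0" using h assms(1,2) by auto
  have e0: "e \<noteq> 0" using h assms(2,3) by (auto simp: e_def)
  have prod: "(e - k) * (e + k) = - 2 * h * e"
    using h k unfolding e_def by algebra
  then have nz: "e - k \<noteq> 0" "e + k \<noteq> 0" using h0 e0 by auto
  then show "c - k \<noteq> h" "c + k \<noteq> h" by (auto simp: e_def algebra_simps)
  have "inverse (e - k) + inverse (e + k) = ((e + k) + (e - k)) / ((e - k) * (e + k))"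
    using nz by (simp add: field_simps)
  also have "\<dots> = - inverse h"
    using h0 e0 by (simp only: prod) (simp add: field_simps)
  finally have "cnj (inverse (e - k) + inverse (e + k)) = cnj (- inverse h)" by (rule arg_cong)
  then show "inversion (c - k - h) + inversion (c + k - h) = - inversion h"
    by (simp add: inversion_complex e_def algebra_simps)
qed

lemma mean_bisectors_harmonic:
  fixes b c :: "real^3"
  assumes "b \<noteq> 0" "c \<noteq> 0" "b \<noteq> c" "\<not> opposed b c" "\<not> opposed (c - b) c"
  defines "h \<equiv> mean_bisector b c" and "k \<equiv> mean_bisector (c - b) c"
  shows "h \<noteq> 0" "c - k \<noteq> h" "c + k \<noteq> h"
    "inversion (c - k - h) + inversion (c + k - h) = - inversion h"
proof -
  obtain L b' c' where "linear L" "\<And>z. norm (L z) = norm z" and bc: "b = L b'" "c = L (c' :: complex)"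
    by (rule complex_plane_through_two_vectors[of b c]) (auto simp: image_iff)
  then interpret isometric_embedding L by (intro isometric_embedding.intro)
  have "b' \<noteq> 0" "c' \<noteq> 0" "b' \<noteq> c'" "\<not> opposed b' c'" "\<not> opposed (c' - b') c'"
    using assms(1-5) by (auto simp: bc eq_0_iff L_simps opposed)
  note c = complex_mean_bisectors_harmonic[OF this]
  show "h \<noteq> 0" "c - k \<noteq> h" "c + k \<noteq> h"
    "inversion (c - k - h) + inversion (c + k - h) = - inversion h"
    using c by (simp_all add: h_def k_def bc L_simps opposed inversion mean_bisector inject eq_0_iff)
qed

text \<open>Each of the four points is brought into the picture inverted at \<open>d\<close> by whichever description
  has \<open>d\<close> in the third or fourth place, after a swap of the outer or inner arguments if needed.\<close>

lemma four_points_inverted: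
  assumes "f_defined d a b c" "f_defined a b c d" "f_defined b c d a" "f_defined c d a b"
  defines "A \<equiv> inversion (a - d)" and "B \<equiv> inversion (b - d)" and "C \<equiv> inversion (c - d)"
  defines "h \<equiv> mean_bisector (B - A) (C - A)" and "k \<equiv> mean_bisector (C - B) (C - A)"
  shows "f_point d a b c = from_inverted d (C - k)" "f_point a b c d = from_inverted d (A + h)"
    "f_point b c d a = from_inverted d (C + k)" "f_point c d a b = from_inverted d (A - h)"
    "\<not> opposed (B - A) (C - A)" "\<not> opposed (C - B) (C - A)"
proof -
  have D: "distinct [a, b, c, d]" using assms(2) by (simp add: f_defined_def)
  have m: "mean_bisector (- x) (- y) = - mean_bisector x y" for x y :: "real^3"
    using mean_bisector_scaleR[of "-1" x y] by simp
  have "f_point d a b c = f_point c a b d" "f_defined c a b d"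
    using assms f_point_swap_outer f_defined_swap_outer by blast+
  moreover have "mean_bisector (A - C) (B - C) = - k"
    using m[of "C - A" "C - B"] by (simp add: k_def mean_bisector_commute)
  ultimately show "f_point d a b c = from_inverted d (C - k)"
    using f_point_via_fourth(2)[of c a b d] D
    by (auto simp flip: A_def B_def C_def)
  show "f_point a b c d = from_inverted d (A + h)" "\<not> opposed (B - A) (C - A)"
    using f_point_via_fourth[OF D] assms(2) by (simp_all add: A_def B_def C_def h_def)
  show "f_point b c d a = from_inverted d (C + k)" "\<not> opposed (C - B) (C - A)"
    using f_point_via_third[of b c d a] D assms(3) by (auto simp: A_def B_def C_def k_def)
  have "f_point c d a b = f_point c a d b" "f_defined c a d b"
    using assms f_point_swap_inner f_defined_swap_inner by blast+
  moreover have "mean_bisector (A - C) (A - B) = - h"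
    using m[of "C - A" "B - A"] by (simp add: h_def mean_bisector_commute)
  ultimately show "f_point c d a b = from_inverted d (A - h)"
    using f_point_via_third(2)[of c a d b] D
    by (auto simp flip: A_def B_def C_def)
qed

text \<open>Inverting at \<open>Y\<close> sends the harmonic conjugate of \<open>Y\<close> to the midpoint of the other two images. The
  equation covers infinity too: the fourth point is at infinity exactly when that midpoint
  is \<open>0\<close>.\<close>

lemma four_points_harmonic:
  assumes def: "f_defined d a b c" "f_defined a b c d" "f_defined b c d a" "f_defined c d a b"
    and X: "f_point d a b c = Some X" and Y: "f_point a b c d = Some Y" and Z: "f_point b c d a = Some Z"
  shows "X \<noteq> Y" "Z \<noteq> Y"
    "f_point c d a b = from_inverted Y ((inversion (X - Y) + inversion (Z - Y)) /\<^sub>R 2)"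
proof -
  define A B C where "A = inversion (a - d)" and "B = inversion (b - d)" and "C = inversion (c - d)"
  define h k where "h = mean_bisector (B - A) (C - A)" and "k = mean_bisector (C - B) (C - A)"
  have D: "distinct [a, b, c, d]" using def by (simp add: f_defined_def)
  note 4 = four_points_inverted[OF def, folded A_def B_def C_def, folded h_def k_def]
  define P where "P = A + h"
  have "B - A \<noteq> 0" "C - A \<noteq> 0" "B - A \<noteq> C - A"
    using D by (auto simp: A_def B_def C_def)
  moreover have "(C - A) - (B - A) = C - B" by simp
  ultimately have harm: "h \<noteq> 0" "(C - A) - k \<noteq> h" "(C - A) + k \<noteq> h"
    "inversion ((C - A) - k - h) + inversion ((C - A) + k - h) = - inversion h"
    using mean_bisectors_harmonic[of "B - A" "C - A"] 4(5,6) by (simp_all only: h_def k_def simp_thms)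
  have nz: "C - k \<noteq> 0" "P \<noteq> 0" "C + k \<noteq> 0"
    using X Y Z by (auto simp: 4 from_inverted_def P_def split: if_splits)
  have XYZ: "X = d + inversion (C - k)" "Y = d + inversion P" "Z = d + inversion (C + k)"
    using X Y Z nz by (auto simp: 4 from_inverted_def P_def)
  have ne: "C - k \<noteq> P" "C + k \<noteq> P" using harm by (auto simp: P_def algebra_simps)
  show "X \<noteq> Y" "Z \<noteq> Y" using ne by (auto simp: XYZ)
  have "inversion (X - Y) = reflect P (inversion (C - k - P)) - P"
       "inversion (Z - Y) = reflect P (inversion (C + k - P)) - P"
    using inversion_diff_inversion[OF nz(1,2) ne(1)] inversion_diff_inversion[OF nz(3,2) ne(2)]
    by (simp_all add: XYZ)
  then have "inversion (X - Y) + inversion (Z - Y)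
      = reflect P (inversion (C - k - P) + inversion (C + k - P)) - 2 *\<^sub>R P"
    by (simp add: reflect_linear scaleR_2)
  also have "inversion (C - k - P) + inversion (C + k - P) = - inversion h"
    using harm(4) by (simp add: P_def algebra_simps)
  finally have mean: "(inversion (X - Y) + inversion (Z - Y)) /\<^sub>R 2 = reflect P (inversion (- 2 *\<^sub>R h)) - P"
    by (simp add: reflect_linear inversion_scaleR scaleR_diff_right)
  show "f_point c d a b = from_inverted Y ((inversion (X - Y) + inversion (Z - Y)) /\<^sub>R 2)"
  proof (cases "A = h")
    case True
    then have "- 2 *\<^sub>R h = - P" by (simp add: P_def scaleR_2)
    then show ?thesis using reflect_self[OF nz(2)] True
      unfolding mean by (simp add: reflect_linear 4 from_inverted_def)
  next
    case False
    have "A - h - P = - 2 *\<^sub>R h" by (simp add: P_def scaleR_2)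
    then have "A - h \<noteq> P" using harm(1) by auto
    then have m: "reflect P (inversion (- 2 *\<^sub>R h)) - P = inversion (inversion (A - h) - inversion P)"
      using inversion_diff_inversion[of "A - h" P] False nz(2) \<open>A - h - P = _\<close> by simp
    show ?thesis using False \<open>A - h \<noteq> P\<close>
      unfolding mean m by (simp add: 4 from_inverted_def XYZ)
  qed
qed

section \<open>The curvature circle and its frame\<close>

lemma orthogonal_to_independent_pair:
  fixes x z v :: "real^3"
  assumes "z \<times> x \<noteq> 0" "v \<bullet> x = 0" "v \<bullet> z = 0" 
  shows "v = ((v \<bullet> (z \<times> x)) / (norm (z \<times> x))\<^sup>2) *\<^sub>R (z \<times> x)"
proof -
  define n where "n = z \<times> x"
  define u where "u = v - ((v \<bullet> n) / (norm n)\<^sup>2) *\<^sub>R n"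
  have "u \<bullet> n = 0"
    using assms(1) by (simp add: u_def n_def inner_diff_left power2_norm_eq_inner)
  moreover have "u \<bullet> x = 0" "u \<bullet> z = 0"
    using assms(2,3) by (simp_all add: u_def n_def inner_diff_left dot_cross_self)
  then have "u \<times> n = 0"
    by (simp add: n_def Lagrange)
  ultimately have "u = 0"
    using norm_and_cross_eq_0[of u n] assms(1) by (auto simp: n_def)
  then show ?thesis by (simp add: u_def n_def)
qed

text \<open>A circle through \<open>y\<close> becomes a line under inversion at \<open>y\<close>; \<open>w\<close> is the vector from \<open>y\<close> to the
  centre of the circle.\<close>

lemma circle3_through:
  fixes x w n :: "real^3"
  assumes "x \<noteq> 0" "y \<in> circle3 (y + w) r n"
  shows "y + inversion x \<in> circle3 (y + w) r n \<longleftrightarrow> x \<bullet> w = 1 / 2 \<and> n \<bullet> x = 0"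
proof -
  have w: "norm w = r" "n \<bullet> w = 0"
    using assms(2) by (auto simp: circle3_def dist_norm)
  have "dist (y + w) (y + inversion x) = r \<longleftrightarrow> (norm (w - inversion x))\<^sup>2 = (norm w)\<^sup>2"
    using w by (auto simp: dist_norm power2_eq_iff_nonneg)
  also have "(norm (w - inversion x))\<^sup>2 = (norm w)\<^sup>2 + (norm (inversion x))\<^sup>2 - 2 * (inversion x \<bullet> w)"
    by (simp add: power2_norm_eq_inner inner_simps inner_commute)
  also have "\<dots> = (norm w)\<^sup>2 + (1 - 2 * (x \<bullet> w)) / (norm x)\<^sup>2"
    by (simp add: norm_inversion) (simp add: inversion_def field_simps diff_divide_distrib)
  also have "\<dots> = (norm w)\<^sup>2 \<longleftrightarrow> x \<bullet> w = 1 / 2"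
    using assms(1) by auto
  finally have "dist (y + w) (y + inversion x) = r \<longleftrightarrow> x \<bullet> w = 1 / 2" .
  moreover have "n \<bullet> (inversion x - w) = 0 \<longleftrightarrow> n \<bullet> x = 0"
    using assms(1) w by (simp add: inner_diff_right inversion_def)
  ultimately show ?thesis by (simp add: circle3_def)
qed

lemma sgn_cross_orthogonal:
  fixes x y :: "real^3"
  assumes "x \<bullet> y = 0"
  shows "sgn (x \<times> y) = sgn x \<times> sgn y"
proof -
  have "norm (x \<times> y) = norm x * norm y"
    using norm_cross[of x y] assms power2_eq_iff_nonneg[of "norm (x \<times> y)" "norm x * norm y"]
    by (simp add: power_mult_distrib)
  then show ?thesis
    by (simp add: sgn_div_norm cross_mult_left cross_mult_right)
qed

text \<open>Inverted at \<open>Y\<close>, the circle is the line through \<open>x\<close> and \<open>z\<close>. Being tangent to the circle at \<open>Y\<close> means being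
  parallel to this line, and the centre lies in the direction from \<open>Y\<close> to the foot of the
  perpendicular to it. Linear independence of \<open>x\<close> and \<open>z\<close> keeps the line away from \<open>Y\<close> and so
  makes the circle genuine and unique.\<close>

lemma discrete_frenet_frame_iff:
  fixes \<gamma> :: "int \<Rightarrow> real^3" and i :: int
  defines "a \<equiv> \<gamma> (i - 1)" and "b \<equiv> \<gamma> i" and "c \<equiv> \<gamma> (i + 1)" and "d \<equiv> \<gamma> (i + 2)"
  assumes def: "f_defined d a b c" "f_defined a b c d" "f_defined b c d a" "f_defined c d a b"
    and X: "f_point d a b c = Some X" and Y: "f_point a b c d = Some Y" and Z: "f_point b c d a = Some Z"
  defines "x \<equiv> inversion (X - Y)" and "z \<equiv> inversion (Z - Y)"
  assumes indep: "z \<times> x \<noteq> 0" and direction: "(z - x) \<bullet> (c - b) > 0"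
  shows "discrete_frenet_frame \<gamma> i T N B \<longleftrightarrow>
    T = sgn (z - x) \<and> N = sgn (z \<times> x) \<times> sgn (z - x) \<and> B = sgn (z \<times> x)"
proof -
  define m where "m = z \<times> x"
  \<comment> \<open>the vector from \<open>Y\<close> to the centre: the solution of \<open>x \<bullet> w = z \<bullet> w = 1/2\<close>, \<open>m \<bullet> w = 0\<close>\<close>
  define w where "w = (1 / (2 * (norm m)\<^sup>2)) *\<^sub>R (m \<times> (z - x))"
  have m0: "m \<noteq> 0" using indep by (simp add: m_def)
  have mx: "m \<bullet> x = 0" "m \<bullet> z = 0" by (simp_all add: m_def dot_cross_self)
  have nz: "x \<noteq> 0" "z \<noteq> 0" "z - x \<noteq> 0" using indep by (auto simp: cross_refl)
  have "x + z \<noteq> 0"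
  proof
    assume "x + z = 0"
    then have "z = - x" by (simp add: add_eq_0_iff)
    then show False using indep by (simp add: cross_refl)
  qed
  then have hz: "(x + z) /\<^sub>R 2 \<noteq> 0" by simp
  note four = four_points_harmonic[OF def X Y Z, folded x_def z_def]
  have W: "f_point c d a b = Some (Y + inversion ((x + z) /\<^sub>R 2))"
    using four(3) hz by (simp add: from_inverted_def)
  have XZ: "X = Y + inversion x" "Z = Y + inversion z"
    by (simp_all add: x_def z_def)
  have "(m \<times> (z - x)) \<bullet> x = m \<bullet> m" "(m \<times> (z - x)) \<bullet> z = m \<bullet> m"
    by (simp_all add: m_def cross_components inner_vec_def sum_3 algebra_simps)
  then have w: "x \<bullet> w = 1/2" "z \<bullet> w = 1/2" "m \<bullet> w = 0"
    using m0 by (simp_all add: w_def inner_commute power2_norm_eq_inner dot_cross_self field_simps)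
  have w0: "w \<noteq> 0" using w by auto
  have orth: "m \<bullet> (z - x) = 0" by (simp add: inner_diff_right mx)
  have "sgn w = sgn (m \<times> (z - x))"
    using m0 by (simp add: w_def sgn_scaleR)
  also have "\<dots> = sgn m \<times> sgn (z - x)"
    by (rule sgn_cross_orthogonal[OF orth])
  finally have sw: "sgn w = sgn m \<times> sgn (z - x)" .
  have BTN: "sgn (z - x) \<times> (sgn m \<times> sgn (z - x)) = sgn m"
    using nz(3) orth by (simp add: Lagrange inner_commute) (simp add: sgn_div_norm power2_norm_eq_inner[symmetric] power2_eq_square inner_commute)
  have circle: "discrete_curvature_circle \<gamma> i q r n \<longleftrightarrow> 
      q = Y + w \<and> r = norm w \<and> norm n = 1 \<and> n \<bullet> x = 0 \<and> n \<bullet> z = 0" for q r n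
  proof -
    have "discrete_curvature_circle \<gamma> i q r n \<longleftrightarrow> r > 0 \<and> norm n = 1 \<and> 
        {X, Y, Z, Y + inversion ((x + z) /\<^sub>R 2)} \<subseteq> circle3 q r n"
      using def by (auto simp: discrete_curvature_circle_def Let_def X Y Z W image_iff simp flip: a_def b_def c_def d_def)
    also have "\<dots> \<longleftrightarrow> q = Y + w \<and> r = norm w \<and> norm n = 1 \<and> n \<bullet> x = 0 \<and> n \<bullet> z = 0"
    proof
      assume *: "r > 0 \<and> norm n = 1 \<and> {X, Y, Z, Y + inversion ((x + z) /\<^sub>R 2)} \<subseteq> circle3 q r n"
      define v where "v = q - Y"
      have q: "q = Y + v" by (simp add: v_def)
      have y: "Y \<in> circle3 (Y + v) r n" using * q by simp
      have v: "x \<bullet> v = 1/2" "n \<bullet> x = 0" "z \<bullet> v = 1/2" "n \<bullet> z = 0"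
        using circle3_through[OF nz(1) y] circle3_through[OF nz(2) y] * by (auto simp: XZ q)
      have nv: "n \<bullet> v = 0" and r: "norm v = r" using y by (auto simp: circle3_def dist_norm)
      have n: "n = ((n \<bullet> m) / (norm m)\<^sup>2) *\<^sub>R m"
        using orthogonal_to_independent_pair[OF indep, folded m_def] v by blast
      then have "n \<bullet> m \<noteq> 0" using * by auto
      moreover have "((n \<bullet> m) / (norm m)\<^sup>2) * (m \<bullet> v) = 0"
        using nv by (subst (asm) n) simp
      ultimately have "m \<bullet> v = 0" using m0 by simp
      then have "(v - w) \<bullet> x = 0" "(v - w) \<bullet> z = 0" "(v - w) \<bullet> m = 0"
        using v w by (simp_all add: inner_diff_left, simp_all add: inner_commute)
      then have "v - w = 0"
        using orthogonal_to_independent_pair[OF indep, folded m_def, of "v - w"] by simp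
      then show "q = Y + w \<and> r = norm w \<and> norm n = 1 \<and> n \<bullet> x = 0 \<and> n \<bullet> z = 0"
        using q r v * by auto
    next
      assume *: "q = Y + w \<and> r = norm w \<and> norm n = 1 \<and> n \<bullet> x = 0 \<and> n \<bullet> z = 0"
      have "n = ((n \<bullet> m) / (norm m)\<^sup>2) *\<^sub>R m"
        using orthogonal_to_independent_pair[OF indep, folded m_def] * by blast
      then have "n \<bullet> w = 0" using w by (metis inner_scaleR_left mult_zero_right)
      then have y: "Y \<in> circle3 (Y + w) (norm w) n" by (simp add: circle3_def dist_norm)
      have "((x + z) /\<^sub>R 2) \<bullet> w = 1/2" "n \<bullet> ((x + z) /\<^sub>R 2) = 0"
        using * w by (simp_all add: inner_add_left inner_add_right)
      then have "{X, Y, Z, Y + inversion ((x + z) /\<^sub>R 2)} \<subseteq> circle3 (Y + w) (norm w) n"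
        using circle3_through[OF nz(1) y] circle3_through[OF nz(2) y] circle3_through[OF hz y] w * y
        by (auto simp: XZ)
      then show "r > 0 \<and> norm n = 1 \<and> {X, Y, Z, Y + inversion ((x + z) /\<^sub>R 2)} \<subseteq> circle3 q r n"
        using * w0 by auto
    qed
    finally show ?thesis .
  qed
  have n1: "norm (sgn m) = 1" using m0 by (simp add: norm_sgn)
  have sm: "sgn m \<bullet> x = 0" "sgn m \<bullet> z = 0" using mx by (simp_all add: sgn_div_norm)
  have "discrete_frenet_frame \<gamma> i T N B \<longleftrightarrow>
     (\<exists>n. norm n = 1 \<and> n \<bullet> x = 0 \<and> n \<bullet> z = 0 \<and> norm T = 1 \<and> T \<bullet> n = 0 \<and> T \<bullet> w = 0 \<and> T \<bullet> (c - b) > 0 \<and>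
       N = sgn w \<and> B = T \<times> N)"
    unfolding discrete_frenet_frame_def circle
    by (auto simp: Y inner_minus_right simp flip: a_def b_def c_def d_def)
  also have "\<dots> \<longleftrightarrow> T = sgn (z - x) \<and> N = sgn w \<and> B = T \<times> N"
  proof
    assume "\<exists>n. norm n = 1 \<and> n \<bullet> x = 0 \<and> n \<bullet> z = 0 \<and> norm T = 1 \<and> T \<bullet> n = 0 \<and> T \<bullet> w = 0 \<and>
       T \<bullet> (c - b) > 0 \<and> N = sgn w \<and> B = T \<times> N"
    then obtain n where *: "norm n = 1" "n \<bullet> x = 0" "n \<bullet> z = 0" "norm T = 1" "T \<bullet> n = 0" "T \<bullet> w = 0"
      "T \<bullet> (c - b) > 0" and NB: "N = sgn w" "B = T \<times> N" by blast
    define t where "t = z - x"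
    have "n = ((n \<bullet> m) / (norm m)\<^sup>2) *\<^sub>R m"
      using orthogonal_to_independent_pair[OF indep, folded m_def] * by blast
    moreover from this have "n \<bullet> m \<noteq> 0" using *(1) by auto
    ultimately have Tm: "T \<bullet> m = 0" using *(5) m0
      by (metis divide_eq_0_iff inner_scaleR_right mult_eq_0_iff norm_eq_zero power_eq_0_iff)
    have "T \<bullet> (m \<times> t) = 0" using *(6) m0 by (simp add: w_def t_def)
    then have "(T \<times> t) \<bullet> m = 0"
      by (simp add: cross_components inner_vec_def sum_3 algebra_simps)
    moreover have "m \<times> (T \<times> t) = 0"
      using Tm orth by (simp add: Lagrange inner_commute t_def)
    then have "(T \<times> t) \<times> m = 0" by (subst cross_skew) simp
    ultimately have Tt: "T \<times> t = 0" using norm_and_cross_eq_0[of "T \<times> t" m] m0 by auto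
    have t0: "t \<noteq> 0" using nz by (simp add: t_def)
    have "t \<times> (T \<times> t) = (norm t)\<^sup>2 *\<^sub>R T - (t \<bullet> T) *\<^sub>R t"
      by (simp add: Lagrange power2_norm_eq_inner)
    then have "(norm t)\<^sup>2 *\<^sub>R T = (t \<bullet> T) *\<^sub>R t" using Tt by simp
    then have "T = ((t \<bullet> T) / (norm t)\<^sup>2) *\<^sub>R t"
      using t0 by (metis (no_types) divide_inverse_commute norm_eq_zero power_eq_0_iff real_vector.scale_scale right_inverse scaleR_one scaleR_scaleR mult.commute left_inverse)
    then obtain l where T: "T = l *\<^sub>R t" by blast
    then have "l * (t \<bullet> (c - b)) > 0" using *(7) by simp
    then have "l > 0" using direction by (simp add: t_def zero_less_mult_iff)
    then have "sgn T = sgn t" by (simp add: T sgn_scaleR)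
    then have "T = sgn (z - x)" using *(4) by (simp add: t_def sgn_div_norm)
    then show "T = sgn (z - x) \<and> N = sgn w \<and> B = T \<times> N" using NB by simp
  next
    assume TNB: "T = sgn (z - x) \<and> N = sgn w \<and> B = T \<times> N"
    have "sgn (z - x) \<bullet> w = 0" by (simp add: w_def sgn_div_norm dot_cross_self)
    moreover have "sgn (z - x) \<bullet> sgn m = 0" using orth by (simp add: sgn_div_norm inner_commute)
    moreover have "sgn (z - x) \<bullet> (c - b) > 0" using direction nz by (simp add: sgn_div_norm)
    moreover have "norm (sgn (z - x)) = 1" using nz by (simp add: norm_sgn)
    ultimately show "\<exists>n. norm n = 1 \<and> n \<bullet> x = 0 \<and> n \<bullet> z = 0 \<and> norm T = 1 \<and> T \<bullet> n = 0 \<and>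
      T \<bullet> w = 0 \<and> T \<bullet> (c - b) > 0 \<and> N = sgn w \<and> B = T \<times> N"
      using n1 sm TNB by blast
  qed
  finally show ?thesis using sw BTN by (auto simp: m_def)
qed

section \<open>Finite expansions in a real parameter\<close>

text \<open>The \<open>n\<close>-fold divided difference of \<open>f\<close> at \<open>0\<close> is bounded, which means that \<open>f\<close> is a polynomial of degree below
  \<open>n\<close> up to an error \<open>O(\<epsilon>\<^sup>n)\<close>. The recursive form gives short inductive closure proofs, with no
  bookkeeping of coefficients.\<close>

primrec expands :: "nat \<Rightarrow> (real \<Rightarrow> 'a::real_normed_vector) \<Rightarrow> bool" where
  "expands 0 f \<longleftrightarrow> Bfun f (at 0)"
| "expands (Suc n) f \<longleftrightarrow> (\<exists>c g. expands n g \<and> (\<forall>\<^sub>F \<epsilon> in at 0. f \<epsilon> = c + \<epsilon> *\<^sub>R g \<epsilon>))"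

lemma tendsto_scaleR_Bfun:
  fixes g :: "real \<Rightarrow> 'a::real_normed_vector"
  assumes "Bfun g (at (0::real))"
  shows "((\<lambda>\<epsilon>. \<epsilon> *\<^sub>R g \<epsilon>) \<longlongrightarrow> 0) (at 0)"
proof -
  have "Zfun (\<lambda>x. x) (at (0::real))" 
    using tendsto_Zfun_iff[of "\<lambda>x. x" "0::real" "at 0"] tendsto_ident_at[of "0::real" UNIV] by simp
  then have "Zfun (\<lambda>\<epsilon>. \<epsilon> *\<^sub>R g \<epsilon>) (at 0)"
    using assms by (rule bounded_bilinear.Zfun_prod_Bfun[OF bounded_bilinear_scaleR])
  then show ?thesis by (simp add: tendsto_Zfun_iff)
qed

lemma Bfun_of_tendsto: "(f \<longlongrightarrow> l) F \<Longrightarrow> Bfun f F" for f :: "'a \<Rightarrow> 'b::real_normed_vector"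
proof -
  assume "(f \<longlongrightarrow> l) F"
  then have "\<forall>\<^sub>F x in F. dist (f x) l < 1" by (rule tendstoD) simp
  then have "\<forall>\<^sub>F x in F. norm (f x) \<le> norm l + 1"
    by eventually_elim (metis add.commute add_le_cancel_right dist_norm less_eq_real_def norm_triangle_sub order_trans)
  then show "Bfun f F" by (rule BfunI)
qed

lemma Bfun_add: "Bfun f F \<Longrightarrow> Bfun g F \<Longrightarrow> Bfun (\<lambda>x. f x + g x) F" for f :: "'a \<Rightarrow> 'b::real_normed_vector"
proof -
  assume "Bfun f F" "Bfun g F"
  then obtain K L where "\<forall>\<^sub>F x in F. norm (f x) \<le> K" "\<forall>\<^sub>F x in F. norm (g x) \<le> L"
    by (auto elim!: BfunE)
  then have "\<forall>\<^sub>F x in F. norm (f x + g x) \<le> K + L"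
    by eventually_elim (rule norm_triangle_mono)
  then show ?thesis by (rule BfunI)
qed

lemma (in bounded_bilinear) Bfun_prod: "Bfun f F \<Longrightarrow> Bfun g F \<Longrightarrow> Bfun (\<lambda>x. prod (f x) (g x)) F"
proof -
  assume "Bfun f F" "Bfun g F"
  then obtain K L where KL: "\<forall>\<^sub>F x in F. norm (f x) \<le> K" "\<forall>\<^sub>F x in F. norm (g x) \<le> L" and "K > 0"
    by (auto elim!: BfunE)
  obtain M where M: "M > 0" "\<And>a b. norm (prod a b) \<le> norm a * norm b * M" using pos_bounded by blast
  have "\<forall>\<^sub>F x in F. norm (prod (f x) (g x)) \<le> K * L * M"
    using KL
  proof eventually_elim
    case (elim x)
    then have "norm (f x) * norm (g x) \<le> K * L" using \<open>K > 0\<close> by (intro mult_mono) auto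
    then show ?case using M by (meson mult_right_mono less_imp_le order_trans)
  qed
  then show ?thesis by (rule BfunI)
qed

lemma expands_cong:
  assumes "\<forall>\<^sub>F \<epsilon> in at 0. f \<epsilon> = g \<epsilon>"
  shows "expands n f \<longleftrightarrow> expands n g"
proof (cases n)
  case 0
  have "(\<forall>\<^sub>F x in at 0. norm (f x) \<le> K) \<longleftrightarrow> (\<forall>\<^sub>F x in at 0. norm (g x) \<le> K)" for K
    by (rule eventually_subst) (use assms in \<open>auto elim: eventually_mono\<close>)
  then show ?thesis by (simp add: 0 Bfun_def)
next
  case (Suc m)
  have "(\<forall>\<^sub>F \<epsilon> in at 0. f \<epsilon> = c + \<epsilon> *\<^sub>R h \<epsilon>) \<longleftrightarrow> (\<forall>\<^sub>F \<epsilon> in at 0. g \<epsilon> = c + \<epsilon> *\<^sub>R h \<epsilon>)" for c h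
    by (rule eventually_subst) (use assms in \<open>auto elim: eventually_mono\<close>)
  then show ?thesis by (simp add: Suc)
qed

lemma expands_Suc_I: "expands n g \<Longrightarrow> expands (Suc n) (\<lambda>\<epsilon>. c + \<epsilon> *\<^sub>R g \<epsilon>)"
  by (auto intro!: exI[of _ c] exI[of _ g])

lemma expands_bounded: "expands n f \<Longrightarrow> Bfun f (at 0)"
proof (induction n arbitrary: f)
  case (Suc n)
  then obtain c g where g: "expands n g" "\<forall>\<^sub>F \<epsilon> in at 0. f \<epsilon> = c + \<epsilon> *\<^sub>R g \<epsilon>" by auto
  then have "((\<lambda>\<epsilon>. c + \<epsilon> *\<^sub>R g \<epsilon>) \<longlongrightarrow> c + 0) (at 0)"
    by (intro tendsto_add tendsto_const tendsto_scaleR_Bfun Suc.IH)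
  then have "Bfun (\<lambda>\<epsilon>. c + \<epsilon> *\<^sub>R g \<epsilon>) (at 0)" by (rule Bfun_of_tendsto)
  then show ?case using expands_cong[OF g(2), of 0] by simp
qed simp

lemma expands_Suc_tendsto:
  assumes "expands (Suc n) f" "(f \<longlongrightarrow> l) (at 0)"
  obtains g where "expands n g" "\<forall>\<^sub>F \<epsilon> in at 0. f \<epsilon> = l + \<epsilon> *\<^sub>R g \<epsilon>"
proof -
  obtain c g where g: "expands n g" "\<forall>\<^sub>F \<epsilon> in at 0. f \<epsilon> = c + \<epsilon> *\<^sub>R g \<epsilon>" using assms by auto
  then have "((\<lambda>\<epsilon>. c + \<epsilon> *\<^sub>R g \<epsilon>) \<longlongrightarrow> c + 0) (at 0)"
    by (intro tendsto_add tendsto_const tendsto_scaleR_Bfun expands_bounded)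
  then have "(f \<longlongrightarrow> c) (at 0)" using tendsto_cong[OF g(2)] by simp
  then have "c = l" using assms(2) by (meson at_neq_bot tendsto_unique)
  then show ?thesis using that g by blast
qed

lemma expands_Suc_D: "expands (Suc n) f \<Longrightarrow> expands n f"
proof (induction n arbitrary: f)
  case 0
  then show ?case unfolding expands.simps(1) by (rule expands_bounded)
next
  case (Suc n)
  then obtain c g where g: "expands (Suc n) g" "\<forall>\<^sub>F \<epsilon> in at 0. f \<epsilon> = c + \<epsilon> *\<^sub>R g \<epsilon>" by auto
  then show ?case using Suc.IH[of g] by auto
qed

lemma expands_const: "expands n (\<lambda>_. c)"
proof (induction n arbitrary: c)
  case (Suc n)
  then show ?case using expands_Suc_I[of n "\<lambda>_. 0" c] by simp
qed (simp add: Bfun_const)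

lemma expands_add: "expands n f \<Longrightarrow> expands n g \<Longrightarrow> expands n (\<lambda>\<epsilon>. f \<epsilon> + g \<epsilon>)"
proof (induction n arbitrary: f g)
  case 0
  then show ?case by (simp add: Bfun_add)
next
  case (Suc n)
  then obtain c f' d g' where *: "expands n f'" "\<forall>\<^sub>F \<epsilon> in at 0. f \<epsilon> = c + \<epsilon> *\<^sub>R f' \<epsilon>"
     "expands n g'" "\<forall>\<^sub>F \<epsilon> in at 0. g \<epsilon> = d + \<epsilon> *\<^sub>R g' \<epsilon>" by auto
  have "\<forall>\<^sub>F \<epsilon> in at 0. f \<epsilon> + g \<epsilon> = (c + d) + \<epsilon> *\<^sub>R (f' \<epsilon> + g' \<epsilon>)"
    using *(2,4) by eventually_elim (simp add: algebra_simps)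
  then show ?case using Suc.IH[OF *(1,3)] unfolding expands.simps(2) by blast
qed

lemma expands_scaleR_ident: "expands n g \<Longrightarrow> expands n (\<lambda>\<epsilon>. \<epsilon> *\<^sub>R g \<epsilon>)"
  using expands_Suc_D[OF expands_Suc_I[of n g 0]] by simp

lemma (in bounded_bilinear) expands_prod:
  "expands n f \<Longrightarrow> expands n g \<Longrightarrow> expands n (\<lambda>\<epsilon>. prod (f \<epsilon>) (g \<epsilon>))"
proof (induction n arbitrary: f g)
  case 0
  then show ?case by (simp add: Bfun_prod)
next
  case (Suc n)
  then obtain c f' d g' where *: "expands n f'" "\<forall>\<^sub>F \<epsilon> in at 0. f \<epsilon> = c + \<epsilon> *\<^sub>R f' \<epsilon>"
     "expands n g'" "\<forall>\<^sub>F \<epsilon> in at 0. g \<epsilon> = d + \<epsilon> *\<^sub>R g' \<epsilon>" by auto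
  have "\<forall>\<^sub>F \<epsilon> in at 0. prod (f \<epsilon>) (g \<epsilon>) = prod c d + \<epsilon> *\<^sub>R (prod c (g' \<epsilon>) + (prod (f' \<epsilon>) d + \<epsilon> *\<^sub>R prod (f' \<epsilon>) (g' \<epsilon>)))"
    using *(2,4) by eventually_elim (simp add: add_left add_right scaleR_left scaleR_right algebra_simps)
  moreover have "expands n (\<lambda>\<epsilon>. prod c (g' \<epsilon>) + (prod (f' \<epsilon>) d + \<epsilon> *\<^sub>R prod (f' \<epsilon>) (g' \<epsilon>)))"
    by (intro expands_add expands_scaleR_ident Suc.IH * expands_const)
  ultimately show ?case unfolding expands.simps(2) by blast
qed

lemmas expands_scaleR = bounded_bilinear.expands_prod[OF bounded_bilinear_scaleR]
lemmas expands_mult = bounded_bilinear.expands_prod[OF bounded_bilinear_mult]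
lemmas expands_inner = bounded_bilinear.expands_prod[OF bounded_bilinear_inner]
lemmas expands_cross = bounded_bilinear.expands_prod[OF bilinear_cross[unfolded bilinear_conv_bounded_bilinear]]

lemma expands_diff: "expands n f \<Longrightarrow> expands n g \<Longrightarrow> expands n (\<lambda>\<epsilon>. f \<epsilon> - g \<epsilon>)"
  using expands_add[of n f "\<lambda>\<epsilon>. (-1) *\<^sub>R g \<epsilon>"] expands_scaleR[of n "\<lambda>_. -1" g] by (simp add: expands_const)

text \<open>\<open>1/f - 1/l = - \<epsilon> g / (l f)\<close> for \<open>f = l + \<epsilon> g\<close>: the order lost in \<open>g\<close> is regained by the factor
  \<open>\<epsilon>\<close>, so the expansion of \<open>1/f\<close> to order \<open>n\<close> yields the one to order \<open>n + 1\<close>.\<close>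

lemma expands_inverse:
  fixes f :: "real \<Rightarrow> real"
  assumes "expands n f" "(f \<longlongrightarrow> l) (at 0)" "l \<noteq> 0"
  shows "expands n (\<lambda>\<epsilon>. inverse (f \<epsilon>))"
  using assms(1)
proof (induction n)
  case 0
  then show ?case using tendsto_inverse[OF assms(2,3)] by (auto intro: Bfun_of_tendsto)
next
  case (Suc n)
  obtain g where g: "expands n g" "\<forall>\<^sub>F \<epsilon> in at 0. f \<epsilon> = l + \<epsilon> *\<^sub>R g \<epsilon>"
    using expands_Suc_tendsto[OF Suc.prems assms(2)] .
  have "\<forall>\<^sub>F \<epsilon> in at 0. f \<epsilon> \<noteq> 0"
    using assms(2,3) by (rule tendsto_imp_eventually_ne)
  then have "\<forall>\<^sub>F \<epsilon> in at 0. inverse (f \<epsilon>) = inverse l + \<epsilon> *\<^sub>R ((- inverse l) * (g \<epsilon> * inverse (f \<epsilon>)))"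
    using g(2)
  proof eventually_elim
    case (elim \<epsilon>)
    then have "\<epsilon> * g \<epsilon> = f \<epsilon> - l" by simp
    then have "\<epsilon> *\<^sub>R ((- inverse l) * (g \<epsilon> * inverse (f \<epsilon>))) = - inverse l * ((f \<epsilon> - l) * inverse (f \<epsilon>))"
      by (simp add: mult_ac)
    then show ?case using elim(1) assms(3) by (simp add: field_simps)
  qed
  moreover have "expands n (\<lambda>\<epsilon>. (- inverse l) * (g \<epsilon> * inverse (f \<epsilon>)))"
    by (intro expands_mult expands_const g Suc.IH expands_Suc_D[OF Suc.prems])
  ultimately show ?case unfolding expands.simps(2) by blast
qed

text \<open>The same bootstrapping as for the inverse, with \<open>sqrt f - sqrt l = \<epsilon> g / (sqrt f + sqrt l)\<close>.\<close>

lemma expands_sqrt: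
  fixes f :: "real \<Rightarrow> real"
  assumes "expands n f" "(f \<longlongrightarrow> l) (at 0)" "l > 0"
  shows "expands n (\<lambda>\<epsilon>. sqrt (f \<epsilon>))"
  using assms(1)
proof (induction n)
  case 0
  then show ?case using tendsto_real_sqrt[OF assms(2)] by (auto intro: Bfun_of_tendsto)
next
  case (Suc n)
  obtain g where g: "expands n g" "\<forall>\<^sub>F \<epsilon> in at 0. f \<epsilon> = l + \<epsilon> *\<^sub>R g \<epsilon>"
    using expands_Suc_tendsto[OF Suc.prems assms(2)] .
  have "\<forall>\<^sub>F \<epsilon> in at 0. f \<epsilon> > 0"
    using assms(2,3) by (rule order_tendstoD)
  then have "\<forall>\<^sub>F \<epsilon> in at 0. sqrt (f \<epsilon>) = sqrt l + \<epsilon> *\<^sub>R (g \<epsilon> * inverse (sqrt (f \<epsilon>) + sqrt l))"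
    using g(2)
  proof eventually_elim
    case (elim \<epsilon>)
    then have "\<epsilon> * g \<epsilon> = (sqrt (f \<epsilon>) - sqrt l) * (sqrt (f \<epsilon>) + sqrt l)"
      using assms(3) by (simp add: algebra_simps)
    moreover have "sqrt (f \<epsilon>) + sqrt l > 0" using elim assms(3) by (simp add: add_pos_pos)
    ultimately have "\<epsilon> *\<^sub>R (g \<epsilon> * inverse (sqrt (f \<epsilon>) + sqrt l)) = sqrt (f \<epsilon>) - sqrt l"
      by (simp add: mult.assoc[symmetric])
    then show ?case by simp
  qed
  moreover have "expands n (\<lambda>\<epsilon>. g \<epsilon> * inverse (sqrt (f \<epsilon>) + sqrt l))"
  proof (intro expands_mult g expands_inverse[where l = "sqrt l + sqrt l"] expands_add expands_const Suc.IH
      expands_Suc_D[OF Suc.prems])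
    show "((\<lambda>\<epsilon>. sqrt (f \<epsilon>) + sqrt l) \<longlongrightarrow> sqrt l + sqrt l) (at 0)"
      by (intro tendsto_intros assms)
  qed (use assms(3) in simp)
  ultimately show ?case unfolding expands.simps(2) by blast
qed

lemma expands_norm:
  fixes f :: "real \<Rightarrow> 'a::real_inner"
  assumes "expands n f" "(f \<longlongrightarrow> l) (at 0)" "l \<noteq> 0"
  shows "expands n (\<lambda>\<epsilon>. norm (f \<epsilon>))"
  unfolding norm_eq_sqrt_inner
  by (rule expands_sqrt[where l = "l \<bullet> l"]) (use assms in \<open>auto intro!: expands_inner tendsto_intros\<close>)

lemma expands_sgn:
  fixes f :: "real \<Rightarrow> 'a::real_inner"
  assumes "expands n f" "(f \<longlongrightarrow> l) (at 0)" "l \<noteq> 0"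
  shows "expands n (\<lambda>\<epsilon>. sgn (f \<epsilon>))"
  unfolding sgn_div_norm
  by (intro expands_scaleR expands_inverse[where l = "norm l"] expands_norm[where l = l] tendsto_norm assms) 
    (use assms in auto)

lemma expands_inversion:
  fixes f :: "real \<Rightarrow> 'a::real_inner"
  assumes "expands n f" "(f \<longlongrightarrow> l) (at 0)" "l \<noteq> 0"
  shows "expands n (\<lambda>\<epsilon>. inversion (f \<epsilon>))"
  unfolding inversion_def power2_norm_eq_inner
  by (intro expands_scaleR expands_inverse[where l = "l \<bullet> l"] expands_inner tendsto_inner assms) 
    (use assms in auto)

lemma expands_mean_bisector:
  fixes f g :: "real \<Rightarrow> 'a::real_inner"
  assumes f: "expands n f" "(f \<longlongrightarrow> l) (at 0)" "l \<noteq> 0" and g: "expands n g" "(g \<longlongrightarrow> m) (at 0)" "m \<noteq> 0"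
    and "\<not> opposed l m"
  shows "expands n (\<lambda>\<epsilon>. mean_bisector (f \<epsilon>) (g \<epsilon>))"
  unfolding mean_bisector_def 
proof (rule expands_scaleR)
  show "expands n (\<lambda>\<epsilon>. sqrt (norm (f \<epsilon>) * norm (g \<epsilon>)))"
    by (rule expands_sqrt[where l = "norm l * norm m"])
       (use assms in \<open>auto intro!: tendsto_intros expands_mult expands_norm[OF f] expands_norm[OF g]\<close>)
  show "expands n (\<lambda>\<epsilon>. sgn (sgn (f \<epsilon>) + sgn (g \<epsilon>)))"
    by (rule expands_sgn[where l = "sgn l + sgn m"])
       (use assms in \<open>auto simp: opposed_def intro!: tendsto_intros expands_add expands_sgn[OF f] expands_sgn[OF g]\<close>)
qed

lemma eventually_at_0_uminus: "eventually P (at (0::real)) \<Longrightarrow> \<forall>\<^sub>F \<epsilon> in at 0. P (- \<epsilon>)"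
  unfolding eventually_at by (auto simp: dist_real_def)

text \<open>For an even function the coefficient of \<open>\<epsilon>\<close> equals its own negative.\<close>

lemma even_expansion:
  assumes "expands 2 f" "(f \<longlongrightarrow> l) (at 0)" "\<forall>\<^sub>F \<epsilon> in at 0. f (- \<epsilon>) = f \<epsilon>"
  shows "(\<lambda>\<epsilon>. norm (f \<epsilon> - l)) \<in> O[at 0](\<lambda>\<epsilon>. \<epsilon>\<^sup>2)"
proof -
  have "expands (Suc (Suc 0)) f" using assms(1) by (simp add: numeral_2_eq_2)
  then obtain g where g: "expands (Suc 0) g" "\<forall>\<^sub>F \<epsilon> in at 0. f \<epsilon> = l + \<epsilon> *\<^sub>R g \<epsilon>"
    using expands_Suc_tendsto assms(2) by blast
  then obtain c h where h: "expands 0 h" "\<forall>\<^sub>F \<epsilon> in at 0. g \<epsilon> = c + \<epsilon> *\<^sub>R h \<epsilon>" by auto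
  have ne: "\<forall>\<^sub>F \<epsilon> in at (0::real). \<epsilon> \<noteq> 0" by (simp add: eventually_at_filter)
  have lim: "(g \<longlongrightarrow> c) (at 0)"
  proof -
    have "((\<lambda>\<epsilon>. c + \<epsilon> *\<^sub>R h \<epsilon>) \<longlongrightarrow> c + 0) (at 0)"
      using h(1) by (intro tendsto_add tendsto_const tendsto_scaleR_Bfun) simp
    then show ?thesis using tendsto_cong[OF h(2)] by simp
  qed
  have "\<forall>\<^sub>F \<epsilon> in at 0. g \<epsilon> = - g (- \<epsilon>)"
    using g(2) eventually_at_0_uminus[OF g(2)] assms(3) ne
  proof eventually_elim
    case (elim \<epsilon>)
    then have "\<epsilon> *\<^sub>R (g \<epsilon> + g (- \<epsilon>)) = 0" by (simp add: scaleR_add_right)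
    then show ?case using elim(4) by (simp add: eq_neg_iff_add_eq_0)
  qed
  moreover have "((\<lambda>\<epsilon>. g (- \<epsilon>)) \<longlongrightarrow> c) (at 0)"
    using lim eventually_at_0_uminus unfolding tendsto_def by blast
  then have "((\<lambda>\<epsilon>. - g (- \<epsilon>)) \<longlongrightarrow> - c) (at 0)" by (rule tendsto_minus)
  ultimately have "(g \<longlongrightarrow> - c) (at 0)" using tendsto_cong by fast
  then have "c = - c" using lim by (meson at_neq_bot tendsto_unique)
  then have "c + c = 0" by (metis add.left_inverse)
  then have c: "c = 0" by (metis scaleR_2 scale_eq_0_iff zero_neq_numeral)
  obtain K where "\<forall>\<^sub>F \<epsilon> in at 0. norm (h \<epsilon>) \<le> K" using h(1) by (auto elim!: BfunE)
  then have "\<forall>\<^sub>F \<epsilon> in at 0. norm (norm (f \<epsilon> - l)) \<le> K * norm (\<epsilon>\<^sup>2)"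
    using g(2) h(2)
  proof eventually_elim
    case (elim \<epsilon>)
    then have "norm (f \<epsilon> - l) = \<epsilon>\<^sup>2 * norm (h \<epsilon>)" by (simp add: c power2_eq_square)
    then show ?case using elim(1) mult_left_mono[OF elim(1), of "\<epsilon>\<^sup>2"] by (simp add: mult.commute)
  qed
  then show ?thesis by (rule bigoI)
qed

section \<open>Curves close to a straight line\<close>

text \<open>By induction on the order: the derivative of the remainder of \<open>s\<close> is the remainder of \<open>s'\<close>, and the
  mean value inequality gains one factor \<open>|h|\<close>.\<close>

lemma taylor_remainder:
  assumes "C_k_curve n s"
  shows "\<exists>\<delta>>0. \<exists>K. \<forall>h. \<bar>h\<bar> < \<delta> \<longrightarrow>
    norm (s (u + h) - (\<Sum>i<n. (h ^ i / fact i) *\<^sub>R (curve_deriv ^^ i) s u)) \<le> K * \<bar>h\<bar> ^ n"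
  using assms
proof (induction n arbitrary: s)
  case 0
  then have "isCont s u" by (simp add: C_k_curve_def continuous_on_eq_continuous_at)
  then obtain \<delta> where \<delta>: "\<delta> > 0" "\<And>x. dist x u < \<delta> \<Longrightarrow> dist (s x) (s u) < 1"
    unfolding continuous_at_eps_delta by (metis zero_less_one)
  have "norm (s (u + h)) \<le> norm (s u) + 1" if "\<bar>h\<bar> < \<delta>" for h
    using \<delta>(2)[of "u + h"] that norm_triangle_sub[of "s (u + h)" "s u"] by (simp add: dist_norm)
  then show ?case using \<delta>(1) by (intro exI[of _ \<delta>] conjI exI[of _ "norm (s u) + 1"]) auto
next
  case (Suc n)
  define s' where "s' = curve_deriv s"
  have pow: "(curve_deriv ^^ i) s' = (curve_deriv ^^ Suc i) s" for i
    by (simp add: s'_def funpow_swap1)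
  have "C_k_curve n s'"
    using Suc.prems unfolding C_k_curve_def pow by (auto dest: spec[of _ "Suc _"] simp del: funpow.simps)
  then obtain \<delta> K where \<delta>: "\<delta> > 0" and K: "\<And>h. \<bar>h\<bar> < \<delta> \<Longrightarrow>
      norm (s' (u + h) - (\<Sum>i<n. (h ^ i / fact i) *\<^sub>R (curve_deriv ^^ i) s' u)) \<le> K * \<bar>h\<bar> ^ n"
    using Suc.IH by blast
  define r' where "r' h = s' (u + h) - (\<Sum>i<n. (h ^ i / fact i) *\<^sub>R (curve_deriv ^^ i) s' u)" for h
  define r where "r h = s (u + h) - (\<Sum>i<Suc n. (h ^ i / fact i) *\<^sub>R (curve_deriv ^^ i) s u)" for h
  have "(s has_vector_derivative s' t) (at t)" for t
    using Suc.prems unfolding C_k_curve_def s'_def curve_deriv_def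
    by (metis funpow_0 vector_derivative_works zero_less_Suc)
  then have sd: "((\<lambda>h. s (u + h)) has_vector_derivative s' (u + h)) (at h)" for h
    using vector_diff_chain_at[of "\<lambda>h. u + h" "0 + 1" h s "s' (u + h)",
        OF has_vector_derivative_add[OF has_vector_derivative_const has_vector_derivative_id]]
    by (simp add: o_def)
  have r: "(r has_vector_derivative r' h) (at h)" for h
  proof -
    have "((\<lambda>h. \<Sum>i<n. (h ^ Suc i / fact (Suc i)) *\<^sub>R (curve_deriv ^^ i) s' u) has_vector_derivative
       (\<Sum>i<n. (h ^ i / fact i) *\<^sub>R (curve_deriv ^^ i) s' u)) (at h)"
    proof (rule has_vector_derivative_sum)
      fix i
      have "((\<lambda>h. h ^ Suc i / fact (Suc i)) has_real_derivative h ^ i / fact i) (at h)"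
        by (rule derivative_eq_intros refl | simp)+
      then show "((\<lambda>h. (h ^ Suc i / fact (Suc i)) *\<^sub>R (curve_deriv ^^ i) s' u) has_vector_derivative
          (h ^ i / fact i) *\<^sub>R (curve_deriv ^^ i) s' u) (at h)"
        using has_vector_derivative_scaleR[OF _ has_vector_derivative_const] by fastforce
    qed
    then have "((\<lambda>h. s (u + h) - (s u + (\<Sum>i<n. (h ^ Suc i / fact (Suc i)) *\<^sub>R (curve_deriv ^^ i) s' u)))
      has_vector_derivative s' (u + h) - (0 + (\<Sum>i<n. (h ^ i / fact i) *\<^sub>R (curve_deriv ^^ i) s' u))) (at h)"
      by (intro has_vector_derivative_diff has_vector_derivative_add has_vector_derivative_const sd)
    moreover have "r = (\<lambda>h. s (u + h) - (s u + (\<Sum>i<n. (h ^ Suc i / fact (Suc i)) *\<^sub>R (curve_deriv ^^ i) s' u)))"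
      unfolding r_def pow by (subst sum.lessThan_Suc_shift) simp
    ultimately show ?thesis by (simp add: r'_def)
  qed
  have "norm (r h) \<le> K * \<bar>h\<bar> ^ Suc n" if h: "\<bar>h\<bar> < \<delta>" for h
  proof -
    have "norm (r h - r 0) \<le> (K * \<bar>h\<bar> ^ n) * norm (h - 0)"
    proof (rule differentiable_bound)
      show "convex (cball 0 \<bar>h\<bar> :: real set)" by simp
      fix x :: real assume "x \<in> cball 0 \<bar>h\<bar>"
      then have x: "\<bar>x\<bar> \<le> \<bar>h\<bar>" by simp
      show "(r has_derivative (\<lambda>t. t *\<^sub>R r' x)) (at x within cball 0 \<bar>h\<bar>)"
        using r[of x] by (auto simp: has_vector_derivative_def intro: has_derivative_at_withinI)
      have "norm (r' x) \<le> K * \<bar>x\<bar> ^ n" using K[of x] x h by (simp add: r'_def)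
      also have "\<dots> \<le> K * \<bar>h\<bar> ^ n"
      proof (cases "n = 0")
        case False
        have "0 \<le> K * \<bar>h\<bar> ^ n" using K[of h] h order_trans[OF norm_ge_zero] by blast
        then have "h = 0 \<or> K \<ge> 0"
          by (metis not_le zero_le_mult_iff zero_less_abs_iff zero_less_power)
        then show ?thesis using x False
          by (cases "h = 0") (auto intro!: mult_left_mono power_mono)
      qed simp
      finally show "onorm (\<lambda>t. t *\<^sub>R r' x) \<le> K * \<bar>h\<bar> ^ n"
        by (intro onorm_bound) (auto simp: mult.commute intro: order_trans[OF norm_ge_zero] mult_left_mono)
    qed auto
    moreover have "r 0 = 0" by (simp add: r_def sum.lessThan_Suc_shift del: sum.lessThan_Suc)
    ultimately show ?thesis by (simp add: mult_ac)
  qed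
  then show ?case using \<delta> by (auto simp: r_def)
qed

text \<open>Behaviour of points that approach the line along \<open>v\<close>: the limit is \<open>x v\<close>, and the component of the first-order
  displacement orthogonal to \<open>v\<close> is recorded, as a cross product with \<open>v\<close>, by the number \<open>y\<close>. The
  tangential displacement is not tracked. In this form a limit and a first-order deviation
  propagate through all constructions by arithmetic on the pairs \<open>(x, y)\<close>. In the application
  \<open>e = w \<times> v\<close>, and a point on the parabola \<open>t v + \<epsilon> t\<^sup>2 w\<close> has the pair \<open>(t, t\<^sup>2)\<close>.\<close>

definition near_line :: "real^3 \<Rightarrow> real^3 \<Rightarrow> (real \<Rightarrow> real^3) \<Rightarrow> real \<Rightarrow> real \<Rightarrow> bool"
  where "near_line v e f x y \<longleftrightarrow> expands 3 f \<and> (f \<longlongrightarrow> x *\<^sub>R v) (at 0) \<and>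
    ((\<lambda>\<epsilon>. (f \<epsilon> \<times> v) /\<^sub>R \<epsilon>) \<longlongrightarrow> y *\<^sub>R e) (at 0)"

lemmas tendsto_cross3 = bounded_bilinear.tendsto[OF bilinear_cross[unfolded bilinear_conv_bounded_bilinear]]

lemma near_line_add:
  "near_line v e f x y \<Longrightarrow> near_line v e g x' y' \<Longrightarrow> near_line v e (\<lambda>\<epsilon>. f \<epsilon> + g \<epsilon>) (x + x') (y + y')"
  unfolding near_line_def
  by (auto simp: scaleR_add_left scaleR_add_right cross_add_left intro!: tendsto_add expands_add)

lemma near_line_diff:
  "near_line v e f x y \<Longrightarrow> near_line v e g x' y' \<Longrightarrow> near_line v e (\<lambda>\<epsilon>. f \<epsilon> - g \<epsilon>) (x - x') (y - y')"
  unfolding near_line_def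
  by (auto simp: scaleR_diff_left scaleR_diff_right Cross3.left_diff_distrib intro!: tendsto_diff expands_diff)

lemma near_line_scaleR_tendsto:
  assumes "near_line v e f x y" "(c \<longlongrightarrow> k) (at 0)"
  shows "((\<lambda>\<epsilon>. c \<epsilon> *\<^sub>R f \<epsilon>) \<longlongrightarrow> (k * x) *\<^sub>R v) (at 0)"
    "((\<lambda>\<epsilon>. ((c \<epsilon> *\<^sub>R f \<epsilon>) \<times> v) /\<^sub>R \<epsilon>) \<longlongrightarrow> (k * y) *\<^sub>R e) (at 0)"
proof -
  show "((\<lambda>\<epsilon>. c \<epsilon> *\<^sub>R f \<epsilon>) \<longlongrightarrow> (k * x) *\<^sub>R v) (at 0)"
    using tendsto_scaleR[OF assms(2), of f "x *\<^sub>R v"] assms(1) by (simp add: near_line_def)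
  show "((\<lambda>\<epsilon>. ((c \<epsilon> *\<^sub>R f \<epsilon>) \<times> v) /\<^sub>R \<epsilon>) \<longlongrightarrow> (k * y) *\<^sub>R e) (at 0)"
    using tendsto_scaleR[OF assms(2), of "\<lambda>\<epsilon>. (f \<epsilon> \<times> v) /\<^sub>R \<epsilon>" "y *\<^sub>R e"] assms(1)
    by (simp add: near_line_def cross_mult_left mult.commute)
qed

lemma near_line_inversion:
  assumes f: "near_line v e f x y" and v: "norm v = 1" and x: "x \<noteq> 0"
  shows "near_line v e (\<lambda>\<epsilon>. inversion (f \<epsilon>)) (1 / x) (y / x\<^sup>2)"
proof -
  have lim: "(f \<longlongrightarrow> x *\<^sub>R v) (at 0)" "expands 3 f" using f by (auto simp: near_line_def)
  have v0: "v \<noteq> 0" using v by auto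
  have "((\<lambda>\<epsilon>. inverse ((norm (f \<epsilon>))\<^sup>2)) \<longlongrightarrow> inverse ((norm (x *\<^sub>R v))\<^sup>2)) (at 0)"
    using x v0 by (intro tendsto_intros lim) auto
  then have c: "((\<lambda>\<epsilon>. inverse ((norm (f \<epsilon>))\<^sup>2)) \<longlongrightarrow> inverse (x\<^sup>2)) (at 0)"
    by (simp add: v)
  have "inverse (x\<^sup>2) * x = 1 / x" using x by (simp add: power2_eq_square divide_inverse)
  then show ?thesis
    using near_line_scaleR_tendsto[OF f c] expands_inversion[OF lim(2,1)] x v0
    by (simp add: near_line_def inversion_def[symmetric] divide_inverse mult.commute)
qed

text \<open>The bisector is a linear combination of \<open>f\<close> and \<open>g\<close> with convergent coefficients. As the cross products
  of \<open>f\<close> and \<open>g\<close> with \<open>v\<close> vanish in the limit, only the limits of these coefficients enter the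
  deviation.\<close>

lemma near_line_mean_bisector:
  assumes f: "near_line v e f x y" and g: "near_line v e g x' y'" and v: "norm v = 1" and x: "x * x' > 0"
  shows "near_line v e (\<lambda>\<epsilon>. mean_bisector (f \<epsilon>) (g \<epsilon>)) (sgn x * sqrt (x * x'))
     ((sqrt (x' / x) * y + sqrt (x / x') * y') / 2)"
proof -
  have lim: "(f \<longlongrightarrow> x *\<^sub>R v) (at 0)" "(g \<longlongrightarrow> x' *\<^sub>R v) (at 0)" and ex: "expands 3 f" "expands 3 g"
    using f g by (auto simp: near_line_def)
  have nz: "x \<noteq> 0" "x' \<noteq> 0" "v \<noteq> 0" using x v by auto
  have sg: "sgn x' = sgn x" using x by (auto simp: zero_less_mult_iff)
  have no: "sgn (x *\<^sub>R v) + sgn (x' *\<^sub>R v) = (2 * sgn x) *\<^sub>R v"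
  proof -
    have "sgn v = v" using v by (simp add: sgn_div_norm)
    moreover have "(2 * sgn x) *\<^sub>R v = sgn x *\<^sub>R v + sgn x *\<^sub>R v" by (metis mult_2 scaleR_add_left)
    ultimately show ?thesis by (simp add: sgn_scaleR sg)
  qed
  define S where "S \<epsilon> = sgn (f \<epsilon>) + sgn (g \<epsilon>)" for \<epsilon>
  have "(S \<longlongrightarrow> (2 * sgn x) *\<^sub>R v) (at 0)"
    unfolding S_def no[symmetric] using nz by (intro tendsto_intros lim) auto
  then have S: "((\<lambda>\<epsilon>. norm (S \<epsilon>)) \<longlongrightarrow> 2) (at 0)"
    using tendsto_norm[of S "(2 * sgn x) *\<^sub>R v" "at 0"] v nz by (simp add: abs_sgn_eq abs_mult)
  define c where "c k \<epsilon> = sqrt (norm (f \<epsilon>) * norm (g \<epsilon>)) * inverse (norm (S \<epsilon>)) * inverse (norm (k \<epsilon> :: real^3))"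
    for k :: "real \<Rightarrow> real^3" and \<epsilon>
  have mb: "mean_bisector (f \<epsilon>) (g \<epsilon>) = c f \<epsilon> *\<^sub>R f \<epsilon> + c g \<epsilon> *\<^sub>R g \<epsilon>" for \<epsilon>
    unfolding mean_bisector_def S_def[symmetric] sgn_div_norm[of "S \<epsilon>"]
    by (simp add: c_def) (simp add: S_def sgn_div_norm scaleR_add_right mult.assoc)
  have r: "((\<lambda>\<epsilon>. sqrt (norm (f \<epsilon>) * norm (g \<epsilon>)) * inverse (norm (S \<epsilon>))) \<longlongrightarrow> sqrt (\<bar>x\<bar> * \<bar>x'\<bar>) * inverse 2) (at 0)"
    using tendsto_norm[OF lim(1)] tendsto_norm[OF lim(2)] v
    by (intro tendsto_mult tendsto_inverse S tendsto_real_sqrt) auto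
  have cf: "(c f \<longlongrightarrow> sqrt (\<bar>x\<bar> * \<bar>x'\<bar>) * inverse 2 * inverse \<bar>x\<bar>) (at 0)"
    unfolding c_def using tendsto_norm[OF lim(1)] v nz by (intro tendsto_mult r tendsto_inverse) auto
  have cg: "(c g \<longlongrightarrow> sqrt (\<bar>x\<bar> * \<bar>x'\<bar>) * inverse 2 * inverse \<bar>x'\<bar>) (at 0)"
    unfolding c_def using tendsto_norm[OF lim(2)] v nz by (intro tendsto_mult r tendsto_inverse) auto
  have ab: "\<bar>x\<bar> * \<bar>x'\<bar> = x * x'" "x' / x = \<bar>x'\<bar> / \<bar>x\<bar>" "x / x' = \<bar>x\<bar> / \<bar>x'\<bar>"
    using x by (auto simp: zero_less_mult_iff)
  have k1: "sqrt (\<bar>x\<bar> * \<bar>x'\<bar>) * inverse 2 * inverse \<bar>x\<bar> = sqrt (x' / x) / 2"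
    unfolding ab(2) using nz real_sqrt_mult_self[of "\<bar>x\<bar>"] by (simp add: real_sqrt_mult real_sqrt_divide field_simps)
  have k2: "sqrt (\<bar>x\<bar> * \<bar>x'\<bar>) * inverse 2 * inverse \<bar>x'\<bar> = sqrt (x / x') / 2"
    unfolding ab(3) using nz real_sqrt_mult_self[of "\<bar>x'\<bar>"] by (simp add: real_sqrt_mult real_sqrt_divide field_simps)
  have k3: "sqrt (x' / x) / 2 * x + sqrt (x / x') / 2 * x' = sgn x * sqrt (x * x')"
  proof -
    have "sqrt (x' / x) * x = sgn x * sqrt (x * x')" "sqrt (x / x') * x' = sgn x * sqrt (x * x')"
    proof -
      have "sqrt (x' / x) * \<bar>x\<bar> = sqrt (x * x')"
        using k1 nz by (simp add: ab(1) field_simps)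
      then show "sqrt (x' / x) * x = sgn x * sqrt (x * x')"
        by (metis mult.assoc mult.commute mult_sgn_abs)
      have "sqrt (x / x') * \<bar>x'\<bar> = sqrt (x * x')"
        using k2 nz by (simp add: ab(1) field_simps)
      then show "sqrt (x / x') * x' = sgn x * sqrt (x * x')"
        by (metis mult.assoc mult.commute mult_sgn_abs sg)
    qed
    then show ?thesis by simp
  qed
  have "\<not> opposed (x *\<^sub>R v) (x' *\<^sub>R v)"
    using nz by (simp add: opposed_def no sgn_zero_iff)
  then have "expands 3 (\<lambda>\<epsilon>. mean_bisector (f \<epsilon>) (g \<epsilon>))"
    using nz by (intro expands_mean_bisector[OF ex(1) lim(1) _ ex(2) lim(2)]) auto
  moreover have "((\<lambda>\<epsilon>. mean_bisector (f \<epsilon>) (g \<epsilon>)) \<longlongrightarrow> (sgn x * sqrt (x * x')) *\<^sub>R v) (at 0)"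
    using tendsto_add[OF near_line_scaleR_tendsto(1)[OF f cf] near_line_scaleR_tendsto(1)[OF g cg]]
    unfolding k1 k2 mb[symmetric] scaleR_add_left[symmetric] k3 .
  moreover have "((\<lambda>\<epsilon>. (mean_bisector (f \<epsilon>) (g \<epsilon>) \<times> v) /\<^sub>R \<epsilon>) \<longlongrightarrow>
      ((sqrt (x' / x) * y + sqrt (x / x') * y') / 2) *\<^sub>R e) (at 0)"
    using tendsto_add[OF near_line_scaleR_tendsto(2)[OF f cf] near_line_scaleR_tendsto(2)[OF g cg]]
    unfolding k1 k2 scaleR_add_left[symmetric] scaleR_add_right[symmetric] cross_add_left[symmetric] mb[symmetric]
    by (simp add: add_divide_distrib)
  ultimately show ?thesis by (simp add: near_line_def)
qed

text \<open>The limits of \<open>f\<close> and \<open>g\<close> are parallel, so \<open>f \<times> g\<close> vanishes there, and its first-order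
  coefficient depends on the orthogonal deviations only. Dividing by \<open>\<epsilon>\<close> lowers the order of the
  expansion from \<open>3\<close> to \<open>2\<close>.\<close>

lemma near_line_cross_tendsto:
  assumes f: "near_line v e f x y" and g: "near_line v e g x' y'" and v: "norm v = 1"
  shows "((\<lambda>\<epsilon>. (f \<epsilon> \<times> g \<epsilon>) /\<^sub>R \<epsilon>) \<longlongrightarrow> (x' * y - x * y') *\<^sub>R e) (at 0)"
    and "expands 2 (\<lambda>\<epsilon>. (f \<epsilon> \<times> g \<epsilon>) /\<^sub>R \<epsilon>)"
proof -
  have vv: "v \<bullet> v = 1" using v by (simp add: norm_eq_1)
  \<comment> \<open>the last summand is a product of two deviations and hence of second order\<close>
  have id: "p \<times> q = (q \<bullet> v) *\<^sub>R (p \<times> v) - (p \<bullet> v) *\<^sub>R (q \<times> v) + (p \<times> v) \<times> (q \<times> v)" for p q :: "real^3"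
  proof -
    have "(p \<times> v) \<times> (q \<times> v) = (v \<bullet> (p \<times> q)) *\<^sub>R v"
      by (simp add: cross3_simps forall_3)
    moreover have "(v \<bullet> v) *\<^sub>R (p \<times> q) = (q \<bullet> v) *\<^sub>R (p \<times> v) - (p \<bullet> v) *\<^sub>R (q \<times> v) + (v \<bullet> (p \<times> q)) *\<^sub>R v"
      by (simp add: cross3_simps forall_3)
    ultimately show ?thesis by (simp add: vv)
  qed
  define F G where "F \<epsilon> = (f \<epsilon> \<times> v) /\<^sub>R \<epsilon>" and "G \<epsilon> = (g \<epsilon> \<times> v) /\<^sub>R \<epsilon>" for \<epsilon>
  have lim: "(f \<longlongrightarrow> x *\<^sub>R v) (at 0)" "(g \<longlongrightarrow> x' *\<^sub>R v) (at 0)" "(F \<longlongrightarrow> y *\<^sub>R e) (at 0)" "(G \<longlongrightarrow> y' *\<^sub>R e) (at 0)"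
    and ex: "expands 3 f" "expands 3 g"
    using f g by (auto simp: near_line_def F_def[abs_def] G_def[abs_def])
  have ne: "\<forall>\<^sub>F \<epsilon> in at (0::real). \<epsilon> \<noteq> 0" by (simp add: eventually_at_filter)
  have "((\<lambda>\<epsilon>. (g \<epsilon> \<bullet> v) *\<^sub>R F \<epsilon> - (f \<epsilon> \<bullet> v) *\<^sub>R G \<epsilon> + \<epsilon> *\<^sub>R (F \<epsilon> \<times> G \<epsilon>)) \<longlongrightarrow>
     ((x' *\<^sub>R v) \<bullet> v) *\<^sub>R (y *\<^sub>R e) - ((x *\<^sub>R v) \<bullet> v) *\<^sub>R (y' *\<^sub>R e) + 0 *\<^sub>R ((y *\<^sub>R e) \<times> (y' *\<^sub>R e))) (at 0)"
    by (intro tendsto_intros tendsto_cross3 lim)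
  moreover have "\<forall>\<^sub>F \<epsilon> in at 0. (g \<epsilon> \<bullet> v) *\<^sub>R F \<epsilon> - (f \<epsilon> \<bullet> v) *\<^sub>R G \<epsilon> + \<epsilon> *\<^sub>R (F \<epsilon> \<times> G \<epsilon>) = (f \<epsilon> \<times> g \<epsilon>) /\<^sub>R \<epsilon>"
    using ne
  proof eventually_elim
    case (elim \<epsilon>)
    show ?case
      unfolding id[of "f \<epsilon>" "g \<epsilon>"] using elim
      by (simp add: F_def G_def scaleR_add_right scaleR_diff_right cross_mult_left cross_mult_right mult.commute)
  qed
  ultimately show "((\<lambda>\<epsilon>. (f \<epsilon> \<times> g \<epsilon>) /\<^sub>R \<epsilon>) \<longlongrightarrow> (x' * y - x * y') *\<^sub>R e) (at 0)"
    by (simp add: vv scaleR_diff_left tendsto_cong)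
  have "((\<lambda>\<epsilon>. f \<epsilon> \<times> g \<epsilon>) \<longlongrightarrow> (x *\<^sub>R v) \<times> (x' *\<^sub>R v)) (at 0)"
    by (intro tendsto_cross3 lim)
  then have "((\<lambda>\<epsilon>. f \<epsilon> \<times> g \<epsilon>) \<longlongrightarrow> 0) (at 0)" by (simp add: cross_mult_left cross_mult_right)
  moreover have "expands (Suc 2) (\<lambda>\<epsilon>. f \<epsilon> \<times> g \<epsilon>)"
    using expands_cross[OF ex] by (simp add: numeral_3_eq_3 numeral_2_eq_2)
  ultimately obtain h where h: "expands 2 h" "\<forall>\<^sub>F \<epsilon> in at 0. f \<epsilon> \<times> g \<epsilon> = 0 + \<epsilon> *\<^sub>R h \<epsilon>"
    using expands_Suc_tendsto by blast
  have "\<forall>\<^sub>F \<epsilon> in at 0. (f \<epsilon> \<times> g \<epsilon>) /\<^sub>R \<epsilon> = h \<epsilon>"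
    using h(2) ne by eventually_elim simp
  then show "expands 2 (\<lambda>\<epsilon>. (f \<epsilon> \<times> g \<epsilon>) /\<^sub>R \<epsilon>)" using h(1) by (simp add: expands_cong)
qed

section \<open>Asymptotic position of the four points\<close>

lemma near_lineI:
  assumes "\<forall>\<^sub>F \<epsilon> in at 0. f \<epsilon> = x *\<^sub>R v + \<epsilon> *\<^sub>R g \<epsilon>" "expands 2 g" "(g \<longlongrightarrow> q) (at 0)" "q \<times> v = y *\<^sub>R e"
  shows "near_line v e f x y"
proof -
  have ne: "\<forall>\<^sub>F \<epsilon> in at (0::real). \<epsilon> \<noteq> 0" by (simp add: eventually_at_filter)
  have "expands (Suc 2) f" using assms(1,2) unfolding expands.simps(2) by blast
  then have "expands 3 f" by (simp add: numeral_3_eq_3 numeral_2_eq_2)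
  moreover have "((\<lambda>\<epsilon>. x *\<^sub>R v + \<epsilon> *\<^sub>R g \<epsilon>) \<longlongrightarrow> x *\<^sub>R v + 0 *\<^sub>R q) (at 0)"
    by (intro tendsto_intros assms)
  then have "(f \<longlongrightarrow> x *\<^sub>R v) (at 0)" using tendsto_cong[OF assms(1)] by simp
  moreover have "((\<lambda>\<epsilon>. g \<epsilon> \<times> v) \<longlongrightarrow> y *\<^sub>R e) (at 0)"
    using tendsto_cross3[OF assms(3) tendsto_const[of v]] assms(4) by simp
  moreover have "\<forall>\<^sub>F \<epsilon> in at 0. (f \<epsilon> \<times> v) /\<^sub>R \<epsilon> = g \<epsilon> \<times> v"
    using assms(1) ne by eventually_elim (simp add: cross_add_left cross_mult_left)
  ultimately show ?thesis by (simp add: near_line_def tendsto_cong)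
qed

lemma near_line_cong: "near_line v e f x y \<Longrightarrow> x = x' \<Longrightarrow> y = y' \<Longrightarrow> near_line v e f x' y'"
  by simp

text \<open>The scaled sample is \<open>t v + \<epsilon> t\<^sup>2 w + O(\<epsilon>\<^sup>2)\<close>. Since scaling divides by \<open>\<epsilon>\<close>, an expansion to order \<open>3\<close>
  needs the Taylor remainder of \<open>s\<close> to be of order \<open>4\<close>.\<close>

lemma near_line_sample:
  fixes s :: "real \<Rightarrow> real^3" and u t :: real
  assumes s: "C_k_curve 4 s"
  defines "p \<equiv> norm (curve_deriv s u)"
  defines "v \<equiv> curve_deriv s u /\<^sub>R p" and "w \<equiv> curve_deriv (curve_deriv s) u /\<^sub>R (2 * p)"
  assumes p: "p \<noteq> 0"
  shows "near_line v (w \<times> v) (\<lambda>\<epsilon>. (s (u + t * \<epsilon>) - s u) /\<^sub>R (\<epsilon> * p)) t (t\<^sup>2)"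
proof -
  define b where "b = (curve_deriv ^^ 3) s u"
  define r where "r h = s (u + h) - (\<Sum>i<4. (h ^ i / fact i) *\<^sub>R (curve_deriv ^^ i) s u)" for h
  obtain \<delta> K where \<delta>: "\<delta> > 0" "\<And>h. \<bar>h\<bar> < \<delta> \<Longrightarrow> norm (r h) \<le> K * \<bar>h\<bar> ^ 4"
    using taylor_remainder[OF s, of u] unfolding r_def by blast
  define g where "g \<epsilon> = r (t * \<epsilon>) /\<^sub>R (\<epsilon> ^ 4 * p)" for \<epsilon>
  have ne: "\<forall>\<^sub>F \<epsilon> in at (0::real). \<epsilon> \<noteq> 0" by (simp add: eventually_at_filter)
  have "((\<lambda>\<epsilon>. \<bar>t * \<epsilon>\<bar>) \<longlongrightarrow> \<bar>t * 0\<bar>) (at 0)" by (intro tendsto_intros)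
  then have small: "\<forall>\<^sub>F \<epsilon> in at 0. \<bar>t * \<epsilon>\<bar> < \<delta>" using \<delta>(1) by (intro order_tendstoD) auto
  have "\<forall>\<^sub>F \<epsilon> in at 0. norm (g \<epsilon>) \<le> K * t ^ 4 / \<bar>p\<bar>"
    using small ne
  proof eventually_elim
    case (elim \<epsilon>)
    have "norm (g \<epsilon>) = norm (r (t * \<epsilon>)) / (\<epsilon> ^ 4 * \<bar>p\<bar>)" by (simp add: g_def divide_inverse abs_mult)
    also have "\<dots> \<le> (K * \<bar>t * \<epsilon>\<bar> ^ 4) / (\<epsilon> ^ 4 * \<bar>p\<bar>)" using \<delta>(2)[OF elim(1)] by (intro divide_right_mono) auto
    also have "\<dots> = K * t ^ 4 / \<bar>p\<bar>" using elim(2) by (simp add: power_mult_distrib power_even_abs)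
    finally show ?case .
  qed
  then have "Bfun g (at 0)" by (rule BfunI)
  define q where "q \<epsilon> = t\<^sup>2 *\<^sub>R w + \<epsilon> *\<^sub>R ((t ^ 3 / (6 * p)) *\<^sub>R b + \<epsilon> *\<^sub>R g \<epsilon>)" for \<epsilon>
  have q: "expands 2 q" unfolding q_def numeral_2_eq_2 using \<open>Bfun g (at 0)\<close>
    by (intro expands_Suc_I) simp
  have "\<forall>\<^sub>F \<epsilon> in at 0. (s (u + t * \<epsilon>) - s u) /\<^sub>R (\<epsilon> * p) = t *\<^sub>R v + \<epsilon> *\<^sub>R q \<epsilon>"
    using ne
  proof eventually_elim
    case (elim \<epsilon>)
    have f: "fact 2 = (2::real)" "fact 3 = (6::real)" by (simp_all add: fact_numeral)
    have "s (u + t * \<epsilon>) - s u = (t * \<epsilon>) *\<^sub>R (p *\<^sub>R v) + ((t * \<epsilon>)\<^sup>2 / 2) *\<^sub>R ((2 * p) *\<^sub>R w) + ((t * \<epsilon>) ^ 3 / 6) *\<^sub>R b + r (t * \<epsilon>)"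
      using p by (simp add: r_def numeral_eq_Suc v_def w_def b_def)
    moreover have "r (t * \<epsilon>) = (\<epsilon> ^ 4 * p) *\<^sub>R g \<epsilon>"
    proof -
      have "(\<epsilon> ^ 4 * p) * inverse (\<epsilon> ^ 4 * p) = 1" using elim p by (intro right_inverse) simp
      then show ?thesis by (simp only: g_def scaleR_scaleR scaleR_one)
    qed
    moreover have "t * \<epsilon> * p = \<epsilon> * p * t" "(t * \<epsilon>)\<^sup>2 / 2 * (2 * p) = \<epsilon> * p * \<epsilon> * t\<^sup>2"
      "(t * \<epsilon>) ^ 3 / 6 = \<epsilon> * p * \<epsilon> * \<epsilon> * (t ^ 3 / (6 * p))" "\<epsilon> ^ 4 * p = \<epsilon> * p * \<epsilon> * \<epsilon> * \<epsilon>"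
      using p by (simp_all add: power2_eq_square power3_eq_cube power4_eq_xxxx)
    ultimately have "s (u + t * \<epsilon>) - s u = (\<epsilon> * p) *\<^sub>R (t *\<^sub>R v + \<epsilon> *\<^sub>R q \<epsilon>)"
      by (simp only: q_def scaleR_add_right scaleR_scaleR mult.assoc add.assoc)
    moreover have "inverse (\<epsilon> * p) * (\<epsilon> * p) = 1" using elim p by (intro left_inverse) simp
    ultimately show ?case by (simp only: scaleR_scaleR scaleR_one)
  qed
  then show ?thesis
  proof (rule near_lineI[OF _ q])
    have "((\<lambda>\<epsilon>. t\<^sup>2 *\<^sub>R w + \<epsilon> *\<^sub>R ((t ^ 3 / (6 * p)) *\<^sub>R b + \<epsilon> *\<^sub>R g \<epsilon>)) \<longlongrightarrow>
       t\<^sup>2 *\<^sub>R w + 0 *\<^sub>R ((t ^ 3 / (6 * p)) *\<^sub>R b + 0)) (at 0)"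
      by (intro tendsto_intros tendsto_scaleR_Bfun \<open>Bfun g (at 0)\<close>)
    then show "(q \<longlongrightarrow> t\<^sup>2 *\<^sub>R w) (at 0)" by (simp add: q_def[abs_def])
  qed (simp add: cross_mult_left)
qed

lemma f_defined_similarity:
  assumes "l \<noteq> 0"
  shows "f_defined (w + l *\<^sub>R a) (w + l *\<^sub>R b) (w + l *\<^sub>R c) (w + l *\<^sub>R d) \<longleftrightarrow> f_defined a b c d"
proof (cases "distinct [a, b, c, d]")
  case True
  then have D: "distinct [w + l *\<^sub>R a, w + l *\<^sub>R b, w + l *\<^sub>R c, w + l *\<^sub>R d]" using assms by auto
  show ?thesis
    using assms unfolding f_point_via_third(1)[OF True] f_point_via_third(1)[OF D]
    by (simp add: opposed_scaleR inversion_scaleR flip: scaleR_diff_right)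
next
  case False
  then have "\<not> distinct [w + l *\<^sub>R a, w + l *\<^sub>R b, w + l *\<^sub>R c, w + l *\<^sub>R d]" by auto
  then show ?thesis using False unfolding f_defined_def by blast
qed

lemma f_point_similarity:
  assumes "l \<noteq> 0" "f_defined a b c d"
  shows "f_point (w + l *\<^sub>R a) (w + l *\<^sub>R b) (w + l *\<^sub>R c) (w + l *\<^sub>R d) = map_option (\<lambda>p. w + l *\<^sub>R p) (f_point a b c d)"
proof -
  have D: "distinct [a, b, c, d]" using assms(2) by (simp add: f_defined_def)
  then have D': "distinct [w + l *\<^sub>R a, w + l *\<^sub>R b, w + l *\<^sub>R c, w + l *\<^sub>R d]" using assms(1) by auto
  define x y where "x = inversion (b - c) - inversion (a - c)" and "y = inversion (b - c) - inversion (d - c)"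
  have i: "inversion (w + l *\<^sub>R p - (w + l *\<^sub>R q)) = inverse l *\<^sub>R inversion (p - q)" for p q
    by (simp add: inversion_scaleR flip: scaleR_diff_right)
  have "f_point (w + l *\<^sub>R a) (w + l *\<^sub>R b) (w + l *\<^sub>R c) (w + l *\<^sub>R d) =
      from_inverted (w + l *\<^sub>R c) (inverse l *\<^sub>R (inversion (b - c) + mean_bisector x y))"
    using f_point_via_third(2)[OF D'] assms f_defined_similarity[OF assms(1), of w a b c d]
    unfolding i scaleR_diff_right[symmetric] mean_bisector_scaleR scaleR_add_right[of "inverse l", symmetric]
      x_def y_def by blast
  also have "\<dots> = map_option (\<lambda>p. w + l *\<^sub>R p) (from_inverted c (inversion (b - c) + mean_bisector x y))"
  proof -
    have "from_inverted (w + l *\<^sub>R c) (inverse l *\<^sub>R p) = map_option (\<lambda>p. w + l *\<^sub>R p) (from_inverted c p)" for p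
      using assms(1) by (simp add: from_inverted_def inversion_scaleR scaleR_add_right)
    then show ?thesis .
  qed
  also have "from_inverted c (inversion (b - c) + mean_bisector x y) = f_point a b c d"
    using f_point_via_third(2)[OF D] assms(2) by (simp add: x_def y_def)
  finally show ?thesis .
qed

lemma near_line_eventually_neq:
  assumes "near_line v e f x y" "near_line v e g x' y'" "norm v = 1" "x \<noteq> x'"
  shows "\<forall>\<^sub>F \<epsilon> in at 0. f \<epsilon> \<noteq> g \<epsilon>"
proof -
  have "((\<lambda>\<epsilon>. f \<epsilon> - g \<epsilon>) \<longlongrightarrow> (x - x') *\<^sub>R v) (at 0)"
    using near_line_diff[OF assms(1,2)] by (simp add: near_line_def)
  moreover have "(x - x') *\<^sub>R v \<noteq> 0" using assms(3,4) by auto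
  ultimately have "\<forall>\<^sub>F \<epsilon> in at 0. f \<epsilon> - g \<epsilon> \<noteq> 0" by (rule tendsto_imp_eventually_ne)
  then show ?thesis by eventually_elim auto
qed

lemma near_line_const_0: "near_line v e (\<lambda>_. 0) 0 0"
  by (simp add: near_line_def expands_const)

lemma near_line_eventually_not_opposed:
  assumes "near_line v e f x y" "near_line v e g x' y'" "norm v = 1" "x * x' > 0"
  shows "\<forall>\<^sub>F \<epsilon> in at 0. \<not> opposed (f \<epsilon>) (g \<epsilon>)"
proof -
  have nz: "x \<noteq> 0" "x' \<noteq> 0" using assms(4) by auto
  have "near_line v e (\<lambda>\<epsilon>. mean_bisector (f \<epsilon>) (g \<epsilon>)) (sgn x * sqrt (x * x')) ((sqrt (x' / x) * y + sqrt (x / x') * y') / 2)"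
    using near_line_mean_bisector[OF assms] .
  then have "\<forall>\<^sub>F \<epsilon> in at 0. mean_bisector (f \<epsilon>) (g \<epsilon>) \<noteq> 0"
    using near_line_eventually_neq[OF _ near_line_const_0 assms(3)] nz by (simp add: sgn_zero_iff)
  then show ?thesis by eventually_elim (auto simp: opposed_def mean_bisector_def)
qed

text \<open>In the limit the vectors \<open>x\<close>, \<open>y\<close> of \<open>f_point_via_third\<close> are multiples of \<open>v\<close>; the
  hypothesis \<open>pos\<close> says that these multiples have the same sign.\<close>

lemma near_line_eventually_f_defined:
  assumes a: "near_line v e a ta ya" and b: "near_line v e b tb yb" and c: "near_line v e c tc yc" and d: "near_line v e d td yd"
    and v: "norm v = 1" and D: "distinct [ta, tb, tc, td]"
    and pos: "(1 / (tb - tc) - 1 / (ta - tc)) * (1 / (tb - tc) - 1 / (td - tc)) > 0"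
  shows "\<forall>\<^sub>F \<epsilon> in at 0. f_defined (a \<epsilon>) (b \<epsilon>) (c \<epsilon>) (d \<epsilon>)"
proof -
  have nz: "tb - tc \<noteq> 0" "ta - tc \<noteq> 0" "td - tc \<noteq> 0" using D by auto
  note i = near_line_inversion[OF near_line_diff[OF b c] v nz(1)] near_line_inversion[OF near_line_diff[OF a c] v nz(2)]
    near_line_inversion[OF near_line_diff[OF d c] v nz(3)]
  have no: "\<forall>\<^sub>F \<epsilon> in at 0. \<not> opposed (inversion (b \<epsilon> - c \<epsilon>) - inversion (a \<epsilon> - c \<epsilon>)) (inversion (b \<epsilon> - c \<epsilon>) - inversion (d \<epsilon> - c \<epsilon>))"
    by (rule near_line_eventually_not_opposed[OF near_line_diff[OF i(1,2)] near_line_diff[OF i(1,3)] v pos])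
  note neq = near_line_eventually_neq[OF _ _ v]
  have "\<forall>\<^sub>F \<epsilon> in at 0. a \<epsilon> \<noteq> b \<epsilon>" "\<forall>\<^sub>F \<epsilon> in at 0. a \<epsilon> \<noteq> c \<epsilon>" "\<forall>\<^sub>F \<epsilon> in at 0. a \<epsilon> \<noteq> d \<epsilon>"
    "\<forall>\<^sub>F \<epsilon> in at 0. b \<epsilon> \<noteq> c \<epsilon>" "\<forall>\<^sub>F \<epsilon> in at 0. b \<epsilon> \<noteq> d \<epsilon>" "\<forall>\<^sub>F \<epsilon> in at 0. c \<epsilon> \<noteq> d \<epsilon>"
    using D neq[OF a b] neq[OF a c] neq[OF a d] neq[OF b c] neq[OF b d] neq[OF c d] by auto
  then show ?thesis
    using no by eventually_elim (simp add: f_point_via_third(1))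
qed

text \<open>On the line, the involution that swaps \<open>-1\<close> with \<open>1\<close> and \<open>-3\<close> with \<open>3\<close> is \<open>t \<mapsto> -t\<close>, fixing \<open>0\<close> and infinity, and
  the one that swaps \<open>-3\<close> with \<open>-1\<close> and \<open>1\<close> with \<open>3\<close> is \<open>t \<mapsto> 3/t\<close>, fixing \<open>\<plusminus> \<surd>3\<close>. The deviations \<open>3, 0, 3\<close> are again
  the squares of these parameters: to first order, \<open>t \<mapsto> t v + \<epsilon> t\<^sup>2 w\<close> agrees with a Moebius
  transformation, under which the construction of the points is equivariant.\<close>

lemma near_line_four_points:
  assumes a: "near_line v e a (-3) 9" and b: "near_line v e b (-1) 1" and c: "near_line v e c 1 1" and d: "near_line v e d 3 9"
    and v: "norm v = 1"
  obtains X Y Z where "near_line v e X (- sqrt 3) 3" "near_line v e Y 0 0" "near_line v e Z (sqrt 3) 3"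
    "\<forall>\<^sub>F \<epsilon> in at 0. f_defined (d \<epsilon>) (a \<epsilon>) (b \<epsilon>) (c \<epsilon>) \<and> f_defined (a \<epsilon>) (b \<epsilon>) (c \<epsilon>) (d \<epsilon>) \<and>
      f_defined (b \<epsilon>) (c \<epsilon>) (d \<epsilon>) (a \<epsilon>) \<and> f_defined (c \<epsilon>) (d \<epsilon>) (a \<epsilon>) (b \<epsilon>) \<and>
      f_point (d \<epsilon>) (a \<epsilon>) (b \<epsilon>) (c \<epsilon>) = Some (X \<epsilon>) \<and> f_point (a \<epsilon>) (b \<epsilon>) (c \<epsilon>) (d \<epsilon>) = Some (Y \<epsilon>) \<and>
      f_point (b \<epsilon>) (c \<epsilon>) (d \<epsilon>) (a \<epsilon>) = Some (Z \<epsilon>)"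
proof -
  define r where "r = sqrt (3::real)"
  have r: "r * r = 3" "r > 1" "sqrt (1/12) = 1 / (2 * r)" "sqrt (4/3) = 2 / r" "sqrt (3/4) = r / 2"
  proof -
    have "sqrt 12 = sqrt (2\<^sup>2 * 3)" "sqrt 4 = sqrt (2\<^sup>2)" by simp_all
    then have "sqrt 12 = 2 * r" "sqrt 4 = 2" by (simp_all only: r_def real_sqrt_mult real_sqrt_abs abs_numeral)
    then show "sqrt (1/12) = 1 / (2 * r)" "sqrt (4/3) = 2 / r" "sqrt (3/4) = r / 2" "r * r = 3" "r > 1"
      by (simp_all add: real_sqrt_divide r_def)
  qed
  have r2: "r * (r * x) = 3 * x" for x using r(1) by (simp flip: mult.assoc)
  define A B C where "A \<epsilon> = inversion (a \<epsilon> - d \<epsilon>)" and "B \<epsilon> = inversion (b \<epsilon> - d \<epsilon>)"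
    and "C \<epsilon> = inversion (c \<epsilon> - d \<epsilon>)" for \<epsilon>
  have A: "near_line v e A (-1/6) 0" and B: "near_line v e B (-1/4) (-1/2)" and C: "near_line v e C (-1/2) (-2)"
    unfolding A_def B_def C_def
    by (rule near_line_cong[OF near_line_inversion[OF near_line_diff v]], rule a b c d, rule a b c d, simp, simp, simp)+
  define h k where "h \<epsilon> = mean_bisector (B \<epsilon> - A \<epsilon>) (C \<epsilon> - A \<epsilon>)" and "k \<epsilon> = mean_bisector (C \<epsilon> - B \<epsilon>) (C \<epsilon> - A \<epsilon>)" for \<epsilon>
  have sq: "sqrt (1 / 36) = (1/6::real)" "sqrt (1 / 4) = (1/2::real)" "sqrt 4 = (2::real)"
    by (simp_all add: real_sqrt_divide real_sqrt_unique)
  have h: "near_line v e h (-1/6) (-1)"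
    unfolding h_def
    by (rule near_line_cong[OF near_line_mean_bisector[OF near_line_diff[OF B A] near_line_diff[OF C A] v]])
       (simp_all add: sq)
  have k: "near_line v e k (-1 / (2 * r)) (- r)"
    unfolding k_def
    by (rule near_line_cong[OF near_line_mean_bisector[OF near_line_diff[OF C B] near_line_diff[OF C A] v]])
       (use r(1,2) in \<open>simp_all add: r(3,4,5), simp add: field_simps\<close>)
  \<comment> \<open>the coordinates \<open>c' - k\<close>, \<open>a' + h\<close>, \<open>c' + k\<close> from \<open>four_points_inverted\<close>\<close>
  define X Y Z where "X \<epsilon> = d \<epsilon> + inversion (C \<epsilon> - k \<epsilon>)" and "Y \<epsilon> = d \<epsilon> + inversion (A \<epsilon> + h \<epsilon>)"
    and "Z \<epsilon> = d \<epsilon> + inversion (C \<epsilon> + k \<epsilon>)" for \<epsilon>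
  note Pab = near_line_diff[OF C k] and Pbc = near_line_add[OF A h] and Pcd = near_line_add[OF C k]
  have nz: "- 1 / 2 - - 1 / (2 * r) \<noteq> 0" "- 1 / 6 + - 1 / 6 \<noteq> (0::real)" "- 1 / 2 + - 1 / (2 * r) \<noteq> 0"
    using r by (simp_all add: field_simps)
  have X: "near_line v e X (- sqrt 3) 3"
  proof (rule near_line_cong)
    show "near_line v e X (3 + 1 / (- 1 / 2 - - 1 / (2 * r))) (9 + (- 2 - - r) / (- 1 / 2 - - 1 / (2 * r))\<^sup>2)"
      unfolding X_def by (rule near_line_add[OF d near_line_inversion[OF Pab v nz(1)]])
    have e: "- 1 / 2 - - 1 / (2 * r) = - (r - 1) / (2 * r)" using r(1,2) by (simp add: field_simps)
    have "1 / (- (r - 1) / (2 * r)) = - 3 - r"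
      using r(1,2) by (simp add: divide_simps) (simp add: algebra_simps r2)
    then show "3 + 1 / (- 1 / 2 - - 1 / (2 * r)) = - sqrt 3"
      unfolding e by (simp add: r_def)
    have sqe: "(- (r - 1) / (2 * r))\<^sup>2 = (2 - r) / 6"
      using r(1,2) by (simp add: power2_eq_square divide_simps) (simp add: algebra_simps r2)
    have "(2 - r) \<noteq> 0" using r(1,2) by auto
    then show "9 + (- 2 - - r) / (- 1 / 2 - - 1 / (2 * r))\<^sup>2 = 3"
      unfolding e sqe by (simp add: divide_simps)
  qed
  have Z: "near_line v e Z (sqrt 3) 3"
  proof (rule near_line_cong)
    show "near_line v e Z (3 + 1 / (- 1 / 2 + - 1 / (2 * r))) (9 + (- 2 + - r) / (- 1 / 2 + - 1 / (2 * r))\<^sup>2)"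
      unfolding Z_def by (rule near_line_add[OF d near_line_inversion[OF Pcd v nz(3)]])
    have e: "- 1 / 2 + - 1 / (2 * r) = - (r + 1) / (2 * r)" using r(1,2) by (simp add: field_simps)
    have "1 / (- (r + 1) / (2 * r)) = r - 3"
      using r(1,2) by (simp add: divide_simps) (simp add: algebra_simps r2)
    then show "3 + 1 / (- 1 / 2 + - 1 / (2 * r)) = sqrt 3"
      unfolding e by (simp add: r_def)
    have sqe: "(- (r + 1) / (2 * r))\<^sup>2 = (2 + r) / 6"
      using r(1,2) by (simp add: power2_eq_square divide_simps) (simp add: algebra_simps r2)
    have "(2 + r) \<noteq> 0" using r(1,2) by auto
    then show "9 + (- 2 + - r) / (- 1 / 2 + - 1 / (2 * r))\<^sup>2 = 3"
      unfolding e sqe by (simp add: divide_simps)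
  qed
  have Y: "near_line v e Y 0 0"
    unfolding Y_def by (rule near_line_cong[OF near_line_add[OF d near_line_inversion[OF Pbc v nz(2)]]])
      (simp_all add: power2_eq_square)
  have "\<forall>\<^sub>F \<epsilon> in at 0. f_defined (d \<epsilon>) (a \<epsilon>) (b \<epsilon>) (c \<epsilon>)" "\<forall>\<^sub>F \<epsilon> in at 0. f_defined (a \<epsilon>) (b \<epsilon>) (c \<epsilon>) (d \<epsilon>)"
    "\<forall>\<^sub>F \<epsilon> in at 0. f_defined (b \<epsilon>) (c \<epsilon>) (d \<epsilon>) (a \<epsilon>)" "\<forall>\<^sub>F \<epsilon> in at 0. f_defined (c \<epsilon>) (d \<epsilon>) (a \<epsilon>) (b \<epsilon>)"
    using near_line_eventually_f_defined[OF d a b c v] near_line_eventually_f_defined[OF a b c d v]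
      near_line_eventually_f_defined[OF b c d a v] near_line_eventually_f_defined[OF c d a b v]
    by simp_all
  moreover have "\<forall>\<^sub>F \<epsilon> in at 0. C \<epsilon> - k \<epsilon> \<noteq> 0" "\<forall>\<^sub>F \<epsilon> in at 0. A \<epsilon> + h \<epsilon> \<noteq> 0" "\<forall>\<^sub>F \<epsilon> in at 0. C \<epsilon> + k \<epsilon> \<noteq> 0"
    using near_line_eventually_neq[OF Pab near_line_const_0 v nz(1)] near_line_eventually_neq[OF Pbc near_line_const_0 v nz(2)]
      near_line_eventually_neq[OF Pcd near_line_const_0 v nz(3)] by simp_all
  ultimately have "\<forall>\<^sub>F \<epsilon> in at 0. f_defined (d \<epsilon>) (a \<epsilon>) (b \<epsilon>) (c \<epsilon>) \<and> f_defined (a \<epsilon>) (b \<epsilon>) (c \<epsilon>) (d \<epsilon>) \<and>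
      f_defined (b \<epsilon>) (c \<epsilon>) (d \<epsilon>) (a \<epsilon>) \<and> f_defined (c \<epsilon>) (d \<epsilon>) (a \<epsilon>) (b \<epsilon>) \<and>
      f_point (d \<epsilon>) (a \<epsilon>) (b \<epsilon>) (c \<epsilon>) = Some (X \<epsilon>) \<and> f_point (a \<epsilon>) (b \<epsilon>) (c \<epsilon>) (d \<epsilon>) = Some (Y \<epsilon>) \<and>
      f_point (b \<epsilon>) (c \<epsilon>) (d \<epsilon>) (a \<epsilon>) = Some (Z \<epsilon>)"
  proof eventually_elim
    case (elim \<epsilon>)
    note four_points_inverted[OF elim(1-4), folded A_def B_def C_def, folded h_def k_def]
    then show ?case using elim by (simp add: from_inverted_def X_def Y_def Z_def)
  qed
  then show ?thesis by (rule that[OF X Y Z])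
qed

section \<open>The frame of a sampled curve\<close>

lemma sgn_cross_scaleR_both: "sgn ((l *\<^sub>R x) \<times> (l *\<^sub>R y)) = sgn (x \<times> y)" if "l \<noteq> 0" for x y :: "real^3"
proof -
  have "(l *\<^sub>R x) \<times> (l *\<^sub>R y) = l\<^sup>2 *\<^sub>R (x \<times> y)"
    by (simp add: cross_mult_left cross_mult_right power2_eq_square)
  moreover have "sgn (l\<^sup>2) = (1::real)" using that by (intro sgn_pos) simp
  ultimately show ?thesis by (simp only: sgn_scaleR scaleR_one)
qed

text \<open>Negating \<open>\<epsilon>\<close> reverses the direction of traversal, hence the discrete tangent and binormal. Multiplied
  by \<open>sgn \<epsilon>\<close> they become the even functions \<open>\<tau>\<close> and \<open>\<beta>\<close>; the normal is even by itself.\<close>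

lemma frenet_expansion:
  assumes s: "C_k_curve 4 s" and regular: "curve_deriv s u \<noteq> 0" and curved: "curvature s u \<noteq> 0"
  obtains \<tau> \<beta> :: "real \<Rightarrow> real^3" where
    "\<forall>\<^sub>F \<epsilon> in at 0. \<forall>T N B. discrete_frenet_frame (sampled_curve s u \<epsilon>) 0 T N B \<longleftrightarrow>
      T = sgn \<epsilon> *\<^sub>R \<tau> \<epsilon> \<and> N = \<beta> \<epsilon> \<times> \<tau> \<epsilon> \<and> B = sgn \<epsilon> *\<^sub>R \<beta> \<epsilon>"
    "expands 2 \<tau>" "(\<tau> \<longlongrightarrow> frenet_T s u) (at 0)" "\<forall>\<^sub>F \<epsilon> in at 0. \<tau> (- \<epsilon>) = \<tau> \<epsilon>"
    "expands 2 \<beta>" "(\<beta> \<longlongrightarrow> frenet_B s u) (at 0)" "\<forall>\<^sub>F \<epsilon> in at 0. \<beta> (- \<epsilon>) = \<beta> \<epsilon>"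
proof -
  define p where "p = norm (curve_deriv s u)"
  define v where "v = curve_deriv s u /\<^sub>R p"
  define w where "w = curve_deriv (curve_deriv s) u /\<^sub>R (2 * p)"
  have p: "p > 0" using regular by (simp add: p_def)
  have v: "norm v = 1" using p by (simp add: v_def) (simp add: p_def)
  have T: "frenet_T s u = v" by (simp add: frenet_T_def v_def p_def)
  have vw: "v \<times> w = (1 / (2 * p\<^sup>2)) *\<^sub>R (curve_deriv s u \<times> curve_deriv (curve_deriv s) u)"
  proof -
    have "inverse (2 * p) * inverse p = 1 / (2 * p\<^sup>2)" using p by (simp add: power2_eq_square field_simps)
    then show ?thesis by (simp only: v_def w_def cross_mult_left cross_mult_right scaleR_scaleR)
  qed
  have vw0: "v \<times> w \<noteq> 0" using curved p by (simp add: vw curvature_def)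
  have B: "frenet_B s u = sgn (v \<times> w)"
    using p by (simp add: vw sgn_scaleR) (simp add: frenet_B_def sgn_div_norm)
  have wv: "w \<times> v = - (v \<times> w)" by (rule cross_skew)
  define S where "S t \<epsilon> = (s (u + t * \<epsilon>) - s u) /\<^sub>R (\<epsilon> * p)" for t \<epsilon>
  have near: "near_line v (w \<times> v) (S t) t (t\<^sup>2)" for t
    using near_line_sample[OF s, of u t] p unfolding S_def[abs_def] v_def w_def p_def by simp
  have S_odd: "S t (- \<epsilon>) = - S (- t) \<epsilon>" for t \<epsilon>
    by (simp add: S_def flip: scaleR_minus_left)
  have nearS: "near_line v (w \<times> v) (S (-3)) (-3) 9" "near_line v (w \<times> v) (S (-1)) (-1) 1"
     "near_line v (w \<times> v) (S 1) 1 1" "near_line v (w \<times> v) (S 3) 3 9"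
    using near[of "-3"] near[of "-1"] near[of 1] near[of 3] by simp_all
  obtain X Y Z where XYZ: "near_line v (w \<times> v) X (- sqrt 3) 3" "near_line v (w \<times> v) Y 0 0" "near_line v (w \<times> v) Z (sqrt 3) 3"
    and ev: "\<forall>\<^sub>F \<epsilon> in at 0. f_defined (S 3 \<epsilon>) (S (-3) \<epsilon>) (S (-1) \<epsilon>) (S 1 \<epsilon>) \<and> f_defined (S (-3) \<epsilon>) (S (-1) \<epsilon>) (S 1 \<epsilon>) (S 3 \<epsilon>) \<and>
      f_defined (S (-1) \<epsilon>) (S 1 \<epsilon>) (S 3 \<epsilon>) (S (-3) \<epsilon>) \<and> f_defined (S 1 \<epsilon>) (S 3 \<epsilon>) (S (-3) \<epsilon>) (S (-1) \<epsilon>) \<and>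
      f_point (S 3 \<epsilon>) (S (-3) \<epsilon>) (S (-1) \<epsilon>) (S 1 \<epsilon>) = Some (X \<epsilon>) \<and> f_point (S (-3) \<epsilon>) (S (-1) \<epsilon>) (S 1 \<epsilon>) (S 3 \<epsilon>) = Some (Y \<epsilon>) \<and>
      f_point (S (-1) \<epsilon>) (S 1 \<epsilon>) (S 3 \<epsilon>) (S (-3) \<epsilon>) = Some (Z \<epsilon>)"
    by (rule near_line_four_points[OF nearS v])
  define x z where "x \<epsilon> = inversion (X \<epsilon> - Y \<epsilon>)" and "z \<epsilon> = inversion (Z \<epsilon> - Y \<epsilon>)" for \<epsilon>
  have x: "near_line v (w \<times> v) x (- 1 / sqrt 3) 1"
    unfolding x_def by (rule near_line_cong[OF near_line_inversion[OF near_line_diff[OF XYZ(1,2)] v]]) simp_all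
  have z: "near_line v (w \<times> v) z (1 / sqrt 3) 1"
    unfolding z_def by (rule near_line_cong[OF near_line_inversion[OF near_line_diff[OF XYZ(3,2)] v]]) simp_all
  define t where "t \<epsilon> = z \<epsilon> - x \<epsilon>" for \<epsilon>
  have t: "near_line v (w \<times> v) t (2 / sqrt 3) 0"
    unfolding t_def by (rule near_line_cong[OF near_line_diff[OF z x]]) simp_all
  define m where "m \<epsilon> = (z \<epsilon> \<times> x \<epsilon>) /\<^sub>R \<epsilon>" for \<epsilon>
  have "- 1 / sqrt 3 * 1 - 1 / sqrt 3 * 1 = - (2 / sqrt (3::real))" by simp
  then have m: "(m \<longlongrightarrow> (2 / sqrt 3) *\<^sub>R (v \<times> w)) (at 0)" "expands 2 m"
    using near_line_cross_tendsto[OF z x v] by (simp_all add: m_def[abs_def] wv)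
  have m0: "(2 / sqrt 3) *\<^sub>R (v \<times> w) \<noteq> 0" using vw0 by simp
  have tl: "(t \<longlongrightarrow> (2 / sqrt 3) *\<^sub>R v) (at 0)" and te: "expands 2 t"
    using t expands_Suc_D[of 2 t] by (simp_all add: near_line_def numeral_3_eq_3 numeral_2_eq_2)
  have t0: "(2 / sqrt 3) *\<^sub>R v \<noteq> 0" using v by auto
  define \<tau> \<beta> where "\<tau> \<epsilon> = sgn (t \<epsilon>)" and "\<beta> \<epsilon> = sgn (m \<epsilon>)" for \<epsilon>
  have "sgn v = v" using v by (simp add: sgn_div_norm)
  then have "(\<tau> \<longlongrightarrow> v) (at 0)"
    using tendsto_sgn[OF tl t0] by (simp add: \<tau>_def[abs_def] sgn_scaleR)
  moreover have "(\<beta> \<longlongrightarrow> sgn (v \<times> w)) (at 0)"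
    using tendsto_sgn[OF m(1) m0] by (simp add: \<beta>_def[abs_def] sgn_scaleR)
  moreover have "expands 2 \<tau>" "expands 2 \<beta>"
    unfolding \<tau>_def[abs_def] \<beta>_def[abs_def]
    using expands_sgn[OF te tl t0] expands_sgn[OF m(2,1) m0] by auto
  moreover have "\<forall>\<^sub>F \<epsilon> in at 0. t (- \<epsilon>) = t \<epsilon> \<and> m (- \<epsilon>) = m \<epsilon>"
    using ev eventually_at_0_uminus[OF ev]
  proof eventually_elim
    case (elim \<epsilon>)
    \<comment> \<open>negating \<open>\<epsilon>\<close> replaces the samples \<open>a, b, c, d\<close> by \<open>-d, -c, -b, -a\<close>\<close>
    have minus: "f_point (- a) (- b) (- c) (- d) = map_option uminus (f_point a b c d)" if "f_defined a b c d" for a b c d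
      using f_point_similarity[of "-1" a b c d 0] that by simp
    let ?a = "S (-3) \<epsilon>" and ?b = "S (-1) \<epsilon>" and ?c = "S 1 \<epsilon>" and ?d = "S 3 \<epsilon>"
    have "f_defined ?a ?d ?c ?b" "f_point ?a ?d ?c ?b = Some (Z \<epsilon>)"
      using elim(1) by (metis f_defined_swap_inner f_defined_swap_outer f_point_swap_inner f_point_swap_outer)+
    then have X: "X (- \<epsilon>) = - Z \<epsilon>" using elim(2) minus by (simp add: S_odd)
    have "f_defined ?d ?c ?b ?a" "f_point ?d ?c ?b ?a = Some (Y \<epsilon>)"
      using elim(1) by (metis f_defined_reverse f_point_reverse)+
    then have Y: "Y (- \<epsilon>) = - Y \<epsilon>" using elim(2) minus by (simp add: S_odd)
    have "f_defined ?c ?b ?a ?d" "f_point ?c ?b ?a ?d = Some (X \<epsilon>)"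
      using elim(1) by (metis f_defined_swap_inner f_defined_swap_outer f_point_swap_inner f_point_swap_outer)+
    then have Z: "Z (- \<epsilon>) = - X \<epsilon>" using elim(2) minus by (simp add: S_odd)
    have xz: "x (- \<epsilon>) = - z \<epsilon>" "z (- \<epsilon>) = - x \<epsilon>"
      using inversion_minus[of "Z \<epsilon> - Y \<epsilon>"] inversion_minus[of "X \<epsilon> - Y \<epsilon>"] by (simp_all add: x_def z_def X Y Z)
    then show ?case by (simp add: t_def m_def cross_skew[of "x \<epsilon>"])
  qed
  then have "\<forall>\<^sub>F \<epsilon> in at 0. \<tau> (- \<epsilon>) = \<tau> \<epsilon>" "\<forall>\<^sub>F \<epsilon> in at 0. \<beta> (- \<epsilon>) = \<beta> \<epsilon>"
    by (auto simp: \<tau>_def \<beta>_def elim: eventually_mono)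
  moreover have "\<forall>\<^sub>F \<epsilon> in at 0. \<forall>T N B. discrete_frenet_frame (sampled_curve s u \<epsilon>) 0 T N B \<longleftrightarrow>
      T = sgn \<epsilon> *\<^sub>R \<tau> \<epsilon> \<and> N = \<beta> \<epsilon> \<times> \<tau> \<epsilon> \<and> B = sgn \<epsilon> *\<^sub>R \<beta> \<epsilon>"
  proof -
    have ne: "\<forall>\<^sub>F \<epsilon> in at (0::real). \<epsilon> \<noteq> 0" by (simp add: eventually_at_filter)
    have m_ne: "\<forall>\<^sub>F \<epsilon> in at 0. m \<epsilon> \<noteq> 0" using m(1) m0 by (rule tendsto_imp_eventually_ne)
    have "((\<lambda>\<epsilon>. t \<epsilon> \<bullet> (S 1 \<epsilon> - S (-1) \<epsilon>)) \<longlongrightarrow> ((2 / sqrt 3) *\<^sub>R v) \<bullet> (1 *\<^sub>R v - (-1) *\<^sub>R v)) (at 0)"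
      using nearS(2,3) by (intro tendsto_intros tl) (auto simp: near_line_def)
    moreover have "((2 / sqrt 3) *\<^sub>R v) \<bullet> (1 *\<^sub>R v - (-1) *\<^sub>R v) > 0"
      using v unfolding inner_scaleR_left inner_scaleR_right inner_diff_right norm_eq_1 by simp
    ultimately have pos: "\<forall>\<^sub>F \<epsilon> in at 0. t \<epsilon> \<bullet> (S 1 \<epsilon> - S (-1) \<epsilon>) > 0" by (rule order_tendstoD)
    show ?thesis
      using ev ne m_ne pos
    proof eventually_elim
      case (elim \<epsilon>)
      \<comment> \<open>the frame of the samples themselves is that of the scaled samples, as \<open>x\<close> and \<open>z\<close> are divided by \<open>l\<close>\<close>
      define l where "l = \<epsilon> * p"
      have l: "l \<noteq> 0" "sgn l = sgn \<epsilon>" using elim(2) p by (simp_all add: l_def sgn_mult)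
      have ss: "sgn \<epsilon> * sgn \<epsilon> = 1" "inverse (sgn \<epsilon>) = sgn \<epsilon>"
        "sgn (inverse \<epsilon>) = sgn \<epsilon>" "sgn (inverse l) = sgn \<epsilon>"
        using elim(2) l by (simp_all add: sgn_if)
      define \<gamma> where "\<gamma> = sampled_curve s u \<epsilon>"
      have pts: "\<gamma> (0 - 1) = s u + l *\<^sub>R S (-3) \<epsilon>" "\<gamma> 0 = s u + l *\<^sub>R S (-1) \<epsilon>"
        "\<gamma> (0 + 1) = s u + l *\<^sub>R S 1 \<epsilon>" "\<gamma> (0 + 2) = s u + l *\<^sub>R S 3 \<epsilon>"
        using l(1) by (simp_all add: \<gamma>_def sampled_curve_def S_def flip: l_def)
      have sub: "inversion (s u + l *\<^sub>R a - (s u + l *\<^sub>R b)) = inverse l *\<^sub>R inversion (a - b)" for a b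
        by (simp add: inversion_scaleR flip: scaleR_diff_right)
      have "z \<epsilon> \<times> x \<epsilon> \<noteq> 0" using elim(3) by (auto simp: m_def)
      have zx: "sgn (z \<epsilon> \<times> x \<epsilon>) = sgn \<epsilon> *\<^sub>R \<beta> \<epsilon>"
        using ss by (simp add: \<beta>_def m_def sgn_scaleR)
      have "discrete_frenet_frame \<gamma> 0 T N B \<longleftrightarrow>
          T = sgn (inverse l *\<^sub>R z \<epsilon> - inverse l *\<^sub>R x \<epsilon>) \<and>
          N = sgn ((inverse l *\<^sub>R z \<epsilon>) \<times> (inverse l *\<^sub>R x \<epsilon>)) \<times> sgn (inverse l *\<^sub>R z \<epsilon> - inverse l *\<^sub>R x \<epsilon>) \<and>
          B = sgn ((inverse l *\<^sub>R z \<epsilon>) \<times> (inverse l *\<^sub>R x \<epsilon>))" for T N B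
        unfolding x_def z_def sub[symmetric]
      proof (rule discrete_frenet_frame_iff, unfold pts)
        show "inversion (s u + l *\<^sub>R Z \<epsilon> - (s u + l *\<^sub>R Y \<epsilon>)) \<times> inversion (s u + l *\<^sub>R X \<epsilon> - (s u + l *\<^sub>R Y \<epsilon>)) \<noteq> 0"
          using \<open>z \<epsilon> \<times> x \<epsilon> \<noteq> 0\<close> l(1) unfolding sub x_def z_def by (simp add: cross_mult_left cross_mult_right)
        have "(inverse l *\<^sub>R z \<epsilon> - inverse l *\<^sub>R x \<epsilon>) \<bullet> (l *\<^sub>R S 1 \<epsilon> - l *\<^sub>R S (-1) \<epsilon>) = t \<epsilon> \<bullet> (S 1 \<epsilon> - S (-1) \<epsilon>)"
          using l(1) by (simp add: t_def flip: scaleR_diff_right)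
        then show "0 < (inversion (s u + l *\<^sub>R Z \<epsilon> - (s u + l *\<^sub>R Y \<epsilon>)) - inversion (s u + l *\<^sub>R X \<epsilon> - (s u + l *\<^sub>R Y \<epsilon>))) \<bullet>
            (s u + l *\<^sub>R S 1 \<epsilon> - (s u + l *\<^sub>R S (-1) \<epsilon>))"
          using elim(4) unfolding sub x_def z_def by simp
      qed (use elim(1) l(1) in \<open>simp_all add: f_defined_similarity f_point_similarity\<close>)
      moreover have "sgn (inverse l *\<^sub>R z \<epsilon> - inverse l *\<^sub>R x \<epsilon>) = sgn \<epsilon> *\<^sub>R \<tau> \<epsilon>"
        using l ss by (simp add: \<tau>_def t_def sgn_scaleR sgn_inverse flip: scaleR_diff_right)
      moreover have "sgn ((inverse l *\<^sub>R z \<epsilon>) \<times> (inverse l *\<^sub>R x \<epsilon>)) = sgn \<epsilon> *\<^sub>R \<beta> \<epsilon>"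
        using sgn_cross_scaleR_both[of "inverse l" "z \<epsilon>" "x \<epsilon>"] l(1) zx by simp
      moreover have "(sgn \<epsilon> *\<^sub>R \<beta> \<epsilon>) \<times> (sgn \<epsilon> *\<^sub>R \<tau> \<epsilon>) = \<beta> \<epsilon> \<times> \<tau> \<epsilon>"
        using ss by (simp add: cross_mult_left cross_mult_right)
      ultimately show ?case by (simp only: \<gamma>_def) simp
    qed
  qed
  ultimately show ?thesis by (intro that[of \<tau> \<beta>]) (simp_all only: T B)
qed

theorem corollary31:
  shows "\<exists>k. \<forall>(s :: real \<Rightarrow> real^3) (u :: real).
    C_k_curve k s \<and> regular_curve s \<and> curvature s u \<noteq> 0 \<longrightarrow>
      (\<forall>\<^sub>F \<epsilon> in at 0. \<exists>!(T, N, B). discrete_frenet_frame (sampled_curve s u \<epsilon>) 0 T N B) \<and>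
      (\<forall>T\<^sub>0 N\<^sub>0 B\<^sub>0 :: real \<Rightarrow> real^3.
        (\<forall>\<^sub>F \<epsilon> in at 0. discrete_frenet_frame (sampled_curve s u \<epsilon>) 0 (T\<^sub>0 \<epsilon>) (N\<^sub>0 \<epsilon>) (B\<^sub>0 \<epsilon>)) \<longrightarrow>
        (\<lambda>\<epsilon>. norm (sgn \<epsilon> *\<^sub>R T\<^sub>0 \<epsilon> - frenet_T s u)) \<in> O[at 0](\<lambda>\<epsilon>. \<epsilon>\<^sup>2) \<and>
        (\<lambda>\<epsilon>. norm (N\<^sub>0 \<epsilon> - frenet_N s u)) \<in> O[at 0](\<lambda>\<epsilon>. \<epsilon>\<^sup>2) \<and>
        (\<lambda>\<epsilon>. norm (sgn \<epsilon> *\<^sub>R B\<^sub>0 \<epsilon> - frenet_B s u)) \<in> O[at 0](\<lambda>\<epsilon>. \<epsilon>\<^sup>2))"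
\<comment> \<open>one order is lost by dividing the samples by \<open>\<epsilon>\<close>, another by dividing \<open>z \<times> x\<close> by \<open>\<epsilon>\<close>; order \<open>2\<close> remains\<close>
proof (rule exI[of _ 4], intro allI impI)
  fix s :: "real \<Rightarrow> real^3" and u :: real
  assume *: "C_k_curve 4 s \<and> regular_curve s \<and> curvature s u \<noteq> 0"
  then have "curve_deriv s u \<noteq> 0" by (simp add: regular_curve_def)
  then obtain \<tau> \<beta> where frame:
    "\<forall>\<^sub>F \<epsilon> in at 0. \<forall>T N B. discrete_frenet_frame (sampled_curve s u \<epsilon>) 0 T N B \<longleftrightarrow>
      T = sgn \<epsilon> *\<^sub>R \<tau> \<epsilon> \<and> N = \<beta> \<epsilon> \<times> \<tau> \<epsilon> \<and> B = sgn \<epsilon> *\<^sub>R \<beta> \<epsilon>"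
    and \<tau>: "expands 2 \<tau>" "(\<tau> \<longlongrightarrow> frenet_T s u) (at 0)" "\<forall>\<^sub>F \<epsilon> in at 0. \<tau> (- \<epsilon>) = \<tau> \<epsilon>"
    and \<beta>: "expands 2 \<beta>" "(\<beta> \<longlongrightarrow> frenet_B s u) (at 0)" "\<forall>\<^sub>F \<epsilon> in at 0. \<beta> (- \<epsilon>) = \<beta> \<epsilon>"
    using frenet_expansion * by blast
  have ne: "\<forall>\<^sub>F \<epsilon> in at (0::real). \<epsilon> \<noteq> 0" by (simp add: eventually_at_filter)
  have N: "(\<lambda>\<epsilon>. norm (\<beta> \<epsilon> \<times> \<tau> \<epsilon> - frenet_N s u)) \<in> O[at 0](\<lambda>\<epsilon>. \<epsilon>\<^sup>2)"
  proof (rule even_expansion)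
    show "expands 2 (\<lambda>\<epsilon>. \<beta> \<epsilon> \<times> \<tau> \<epsilon>)" using \<beta>(1) \<tau>(1) by (rule expands_cross)
    show "((\<lambda>\<epsilon>. \<beta> \<epsilon> \<times> \<tau> \<epsilon>) \<longlongrightarrow> frenet_N s u) (at 0)"
      unfolding frenet_N_def using \<beta>(2) \<tau>(2) by (rule tendsto_cross3)
    show "\<forall>\<^sub>F \<epsilon> in at 0. \<beta> (- \<epsilon>) \<times> \<tau> (- \<epsilon>) = \<beta> \<epsilon> \<times> \<tau> \<epsilon>"
      using \<beta>(3) \<tau>(3) by eventually_elim simp
  qed
  show "(\<forall>\<^sub>F \<epsilon> in at 0. \<exists>!(T, N, B). discrete_frenet_frame (sampled_curve s u \<epsilon>) 0 T N B) \<and>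
      (\<forall>T\<^sub>0 N\<^sub>0 B\<^sub>0 :: real \<Rightarrow> real^3.
        (\<forall>\<^sub>F \<epsilon> in at 0. discrete_frenet_frame (sampled_curve s u \<epsilon>) 0 (T\<^sub>0 \<epsilon>) (N\<^sub>0 \<epsilon>) (B\<^sub>0 \<epsilon>)) \<longrightarrow>
        (\<lambda>\<epsilon>. norm (sgn \<epsilon> *\<^sub>R T\<^sub>0 \<epsilon> - frenet_T s u)) \<in> O[at 0](\<lambda>\<epsilon>. \<epsilon>\<^sup>2) \<and>
        (\<lambda>\<epsilon>. norm (N\<^sub>0 \<epsilon> - frenet_N s u)) \<in> O[at 0](\<lambda>\<epsilon>. \<epsilon>\<^sup>2) \<and>
        (\<lambda>\<epsilon>. norm (sgn \<epsilon> *\<^sub>R B\<^sub>0 \<epsilon> - frenet_B s u)) \<in> O[at 0](\<lambda>\<epsilon>. \<epsilon>\<^sup>2))"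
  proof (intro conjI allI impI)
    show "\<forall>\<^sub>F \<epsilon> in at 0. \<exists>!(T, N, B). discrete_frenet_frame (sampled_curve s u \<epsilon>) 0 T N B"
      using frame by eventually_elim auto
    fix T\<^sub>0 N\<^sub>0 B\<^sub>0 :: "real \<Rightarrow> real^3"
    assume "\<forall>\<^sub>F \<epsilon> in at 0. discrete_frenet_frame (sampled_curve s u \<epsilon>) 0 (T\<^sub>0 \<epsilon>) (N\<^sub>0 \<epsilon>) (B\<^sub>0 \<epsilon>)"
    with frame have TNB: "\<forall>\<^sub>F \<epsilon> in at 0. T\<^sub>0 \<epsilon> = sgn \<epsilon> *\<^sub>R \<tau> \<epsilon> \<and> N\<^sub>0 \<epsilon> = \<beta> \<epsilon> \<times> \<tau> \<epsilon> \<and> B\<^sub>0 \<epsilon> = sgn \<epsilon> *\<^sub>R \<beta> \<epsilon>"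
      by eventually_elim blast
    have ss: "sgn \<epsilon> * sgn \<epsilon> = 1" if "\<epsilon> \<noteq> 0" for \<epsilon> :: real using that by (simp add: sgn_if)
    have "\<forall>\<^sub>F \<epsilon> in at 0. norm (sgn \<epsilon> *\<^sub>R T\<^sub>0 \<epsilon> - frenet_T s u) = norm (\<tau> \<epsilon> - frenet_T s u)"
      "\<forall>\<^sub>F \<epsilon> in at 0. norm (N\<^sub>0 \<epsilon> - frenet_N s u) = norm (\<beta> \<epsilon> \<times> \<tau> \<epsilon> - frenet_N s u)"
      "\<forall>\<^sub>F \<epsilon> in at 0. norm (sgn \<epsilon> *\<^sub>R B\<^sub>0 \<epsilon> - frenet_B s u) = norm (\<beta> \<epsilon> - frenet_B s u)"
      using TNB ne by (eventually_elim, simp add: ss)+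
    note cong = this[THEN landau_o.big.in_cong]
    show "(\<lambda>\<epsilon>. norm (sgn \<epsilon> *\<^sub>R T\<^sub>0 \<epsilon> - frenet_T s u)) \<in> O[at 0](\<lambda>\<epsilon>. \<epsilon>\<^sup>2)"
      "(\<lambda>\<epsilon>. norm (N\<^sub>0 \<epsilon> - frenet_N s u)) \<in> O[at 0](\<lambda>\<epsilon>. \<epsilon>\<^sup>2)"
      "(\<lambda>\<epsilon>. norm (sgn \<epsilon> *\<^sub>R B\<^sub>0 \<epsilon> - frenet_B s u)) \<in> O[at 0](\<lambda>\<epsilon>. \<epsilon>\<^sup>2)"
      unfolding cong using even_expansion[OF \<tau>] N even_expansion[OF \<beta>] by blast+
  qed
qed

end
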